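(* For all integers $N \geq 0$ we have $$\Gamma(4, N) = \begin{cases} N, & \text{if } N \leq 2,\\ 3+\dfrac{\Phi(4, N)-5}{4}, & \text{otherwise.}\end{cases}$$
   Context: For $n\in\mathbb{N}=\{0,1,2,\ldots\}$ let $[n]=\{0,1,\ldots,n-1\}$. Consider $p$ pegs labelled by $[p]$ and $N$ disks labelled by $[N]$ in increasing order of size (disk $0$ is the smallest). A configuration is an arrangement of the disks on the pegs in which no disk is placed on top of a smaller one; configurations are identified with functions $\mathbf{u}:[N]\to[p]$ ($\mathbf{u}(D)$ is the peg holding disk $D$). A legal move takes the topmost disk of a peg and places it on another peg which is empty or whose topmost disk is larger; that is, disk $D$ may be moved from peg $x$ to peg $y\ne x$ exactly when no disk smaller than $D$ lies on peg $x$ or peg $y$. The Hanoi graph $\mathcal{H}(p,N)$ has vertex set $[p]^{[N]}$ (all configurations), two configurations being adjacent if one is obtained from the other by a single legal move. A path is a map $\gamma:[T]\to\mathcal{H}(p,N)$, $T\ge 1$, such that $\gamma(t)$ and $\gamma(t+1)$ are adjacent for all $0\le t\le T-2$, i.e. a sequence of legal moves; its length is $\ell(\gamma)=T-1$. The path $\gamma$ is called essential if every disk is moved by $\gamma$ at least once. Define $$\Gamma(p,N)=\min\{\ell(\gamma) : \gamma \text{ is an essential path in } \mathcal{H}(p,N)\}$$ (the minimum is over all essential paths, with arbitrary starting and ending configurations). The Frame–Stewart numbers $\Phi(p,N)$ ($p\ge 3$, $N\ge 1$) are defined by $\Phi(3,N)=2^N-1$, $\Phi(p,1)=1$, and, for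 $p\ge 4$, $N\ge 2$, $$\Phi(p,N)=\min_{1\le \ell<N}\{2\Phi(p,\ell)+\Phi(p-1,N-\ell)\}.$$ *)

theory Defs
  imports Complex_Main "HOL-Library.FuncSet"
begin

definition hanoi_verts :: "nat \<Rightarrow> nat \<Rightarrow> (nat \<Rightarrow> nat) set" where
  "hanoi_verts p N = ({..<N} \<rightarrow>\<^sub>E {..<p})"

definition legal_move :: "nat \<Rightarrow> nat \<Rightarrow> (nat \<Rightarrow> nat) \<Rightarrow> (nat \<Rightarrow> nat) \<Rightarrow> bool" where
  "legal_move p N u v \<longleftrightarrow>
     (\<exists>D<N. \<exists>y<p. y \<noteq> u D \<and> (\<forall>D'<D. u D' \<noteq> u D \<and> u D' \<noteq> y) \<and> v = u(D := y))"

definition hanoi_adj :: "nat \<Rightarrow> nat \<Rightarrow> (nat \<Rightarrow> nat) \<Rightarrow> (nat \<Rightarrow> nat) \<Rightarrow> bool" where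
  "hanoi_adj p N u v \<longleftrightarrow>
     u \<in> hanoi_verts p N \<and> v \<in> hanoi_verts p N \<and> (legal_move p N u v \<or> legal_move p N v u)"

text \<open>A path is the nonempty list of the configurations it visits, so a list of length
  \<open>T\<close> has path length \<open>T - 1\<close>.\<close>

definition hanoi_path :: "nat \<Rightarrow> nat \<Rightarrow> (nat \<Rightarrow> nat) list \<Rightarrow> bool" where
  "hanoi_path p N \<gamma> \<longleftrightarrow>
     \<gamma> \<noteq> [] \<and> set \<gamma> \<subseteq> hanoi_verts p N \<and>
     (\<forall>t. Suc t < length \<gamma> \<longrightarrow> hanoi_adj p N (\<gamma> ! t) (\<gamma> ! Suc t))"

definition path_length :: "(nat \<Rightarrow> nat) list \<Rightarrow> nat" where
  "path_length \<gamma> = length \<gamma> - 1"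

definition essential_path :: "nat \<Rightarrow> nat \<Rightarrow> (nat \<Rightarrow> nat) list \<Rightarrow> bool" where
  "essential_path p N \<gamma> \<longleftrightarrow>
     hanoi_path p N \<gamma> \<and>
     (\<forall>D<N. \<exists>t. Suc t < length \<gamma> \<and> (\<gamma> ! t) D \<noteq> (\<gamma> ! Suc t) D)"

text \<open>On \<^typ>\<open>nat\<close>, \<^term>\<open>Inf\<close> of a nonempty set is its least element; the infimum of
  the empty set is \<open>0\<close>.\<close>

definition hanoi_Gamma :: "nat \<Rightarrow> nat \<Rightarrow> nat" where
  "hanoi_Gamma p N = Inf {path_length \<gamma> | \<gamma>. essential_path p N \<gamma>}"

text \<open>Only the values for \<open>p \<ge> 3\<close> and \<open>N \<ge> 1\<close> are meaningful; the value \<open>0\<close> elsewhere is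
  a convention and does not influence the meaningful values.\<close>

function frame_stewart :: "nat \<Rightarrow> nat \<Rightarrow> nat" where
  "frame_stewart p N =
     (if p < 3 \<or> N = 0 then 0
      else if p = 3 then 2 ^ N - 1
      else if N = 1 then 1
      else Min ((\<lambda>l. 2 * frame_stewart p l + frame_stewart (p - 1) (N - l)) ` {1..<N}))"
  by pat_completeness auto
termination by (relation "measures [fst, snd]") auto

declare frame_stewart.simps [simp del]

lemma frame_stewart_3: "N \<ge> 1 \<Longrightarrow> frame_stewart 3 N = 2 ^ N - 1"
  by (simp add: frame_stewart.simps)

lemma frame_stewart_1: "p \<ge> 3 \<Longrightarrow> frame_stewart p 1 = 1"
  by (simp add: frame_stewart.simps)

lemma frame_stewart_rec:
  "p \<ge> 4 \<Longrightarrow> N \<ge> 2 \<Longrightarrow>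
     frame_stewart p N =
       Min ((\<lambda>l. 2 * frame_stewart p l + frame_stewart (p - 1) (N - l)) ` {1..<N})"
  by (subst frame_stewart.simps) auto

end

theory Submission
  imports Defs
begin

text \<open>Lower bound: consider a move of the largest disk. At that moment all other disks sit on two
  pegs, and the largest disk of each of these two stacks moves at some time, before or after.
  If the two stacks are taken apart independently, Bousch's lower bound for clearing a peg in the
  four-peg game, applied to the disks \<open>A\<close> and \<open>B\<close> above their bottoms, gives
  \<open>3 + \<Psi>(A) + \<Psi>(B)\<close> moves. The bound \<open>\<Psi>(E)\<close> is a maximum of functions \<open>psi l E\<close> which are affine
  in the weights of the disks of \<open>E\<close>, so for a fixed \<open>l\<close> the total depends on \<open>A \<union> B\<close> only, and
  the right choice of \<open>l\<close> gives the claimed value. If both bottom disks first move on the same side of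
  the central move, the second stack may profit from the dismantling of the first; an extension of
  Bousch's induction to two stacks shows that nothing is gained.

  Upper bound: with \<open>\<Phi>(4, N) = 2 \<Phi>(4, N - l - 2) + 2 ^ (l + 2) - 1\<close> and
  \<open>\<Phi>(4, N - l - 2) = 2 \<Phi>(4, m) + 2 ^ (j + 1) - 1\<close>, an explicit path has length
  \<open>3 + \<Phi>(4, m) + (2 ^ j - 1) + (2 ^ l - 1)\<close>.\<close>

section \<open>Weights\<close>

text \<open>A three-peg transfer of \<open>k\<close> disks costs \<open>2 ^ k - 1\<close> moves,
  which is not additive in the disks. This cost is therefore replaced by secant lines of
  \<open>2 ^ k\<close>: at a fixed level \<open>l\<close> an estimate is a constant plus a sum of
  weights, so contributions of several piles and periods can be merged and regrouped. The price is
  that each bound must be shown for every \<open>l\<close>, by an inner induction on the level while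
  the walk stays fixed. Passing from \<open>k\<close> to \<open>Suc k\<close> matters only if there
  are enough disks \<open>e\<close> with \<open>tri (Suc k) \<le> e\<close>, called heavy below; the
  core of the proof is that heavy disks force correspondingly many further moves. The central disk
  and the two bottom disks pay one move each instead of their weight. This loses most when they are
  the three largest disks, whence the sums over \<open>{..<N - 3}\<close>.\<close>

primrec tri :: "nat \<Rightarrow> nat" where
  "tri 0 = 0"
| "tri (Suc l) = tri l + Suc l"

text \<open>If \<open>k\<close> is the largest index with \<open>tri k \<le> e\<close>, then \<open>wt l e = 2 ^ min k l\<close>, and the sum of
  \<open>2 ^ k\<close> over \<open>e < n\<close> is the Frame--Stewart number \<open>\<Phi>(4, n)\<close>.\<close>

primrec wt :: "nat \<Rightarrow> nat \<Rightarrow> int" where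
  "wt 0 e = 1"
| "wt (Suc l) e = wt l e + (if tri (Suc l) \<le> e then 2 ^ l else 0)"

text \<open>The supremum of \<open>psi l E\<close> over \<open>l\<close> is Bousch's function \<open>\<Psi>(E)\<close>. Keeping \<open>l\<close> as a
  parameter makes all estimates linear in the weights.\<close>

definition psi :: "nat \<Rightarrow> nat set \<Rightarrow> int" where
  "psi l E = (1 - int l) * 2 ^ l - 1 + (\<Sum>e\<in>E. wt l e)"

lemma tri_mono: "k \<le> l \<Longrightarrow> tri k \<le> tri l"
  by (induction l) (auto simp: le_Suc_eq)

lemma wt_le: "wt l e \<le> 2 ^ l"
proof (induction l)
  case (Suc l)
  have "(0::int) \<le> 2 ^ l" by simp
  then show ?case using Suc by (simp del: zero_le_power)
qed simp

lemma wt_pos: "1 \<le> wt l e"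
proof (induction l)
  case (Suc l)
  have "(0::int) \<le> 2 ^ l" by simp
  then show ?case using Suc by (auto simp del: zero_le_power)
qed simp

lemma wt_eq: "tri l \<le> e \<Longrightarrow> wt l e = 2 ^ l"
  by (induction l) auto

lemma sum_wt_nonneg: "0 \<le> sum (wt l) A"
  by (meson sum_nonneg wt_pos order_trans zero_le_one)

lemma sum_wt_mono: "finite B \<Longrightarrow> A \<subseteq> B \<Longrightarrow> sum (wt l) A \<le> sum (wt l) B"
  by (rule sum_mono2) (auto intro: order_trans[OF _ wt_pos])

lemma sum_wt_eq: "(\<And>e. e \<in> K \<Longrightarrow> tri l \<le> e) \<Longrightarrow> sum (wt l) K = int (card K) * 2 ^ l"
  by (simp add: wt_eq)

lemma sum_wt_Suc:
  assumes "finite E"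
  shows "sum (wt (Suc l)) E = sum (wt l) E + int (card {e \<in> E. tri (Suc l) \<le> e}) * 2 ^ l"
proof -
  have "sum (wt (Suc l)) E = sum (wt l) E + (\<Sum>e\<in>E. if tri (Suc l) \<le> e then 2 ^ l else 0)"
    by (simp add: sum.distrib)
  also have "(\<Sum>e\<in>E. if tri (Suc l) \<le> e then 2 ^ l else (0::int)) = (\<Sum>e\<in>{e \<in> E. tri (Suc l) \<le> e}. 2 ^ l)"
    by (rule sum.inter_filter[OF assms, symmetric])
  finally show ?thesis by simp
qed

text \<open>Raising the level pays exactly when more than \<open>Suc l\<close> disks of
  \<open>E\<close> are heavy. The induction on the level in \<open>clear_lower\<close> starts from
  this sign.\<close>

lemma psi_Suc:
  assumes "finite E"
  shows "psi (Suc l) E = psi l E + (int (card {e \<in> E. tri (Suc l) \<le> e}) - int (Suc l)) * 2 ^ l"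
  using sum_wt_Suc[OF assms, of l] by (simp add: psi_def algebra_simps)

text \<open>For \<open>k < l\<close> the \<open>k + 1\<close> numbers from \<open>tri k\<close> to
  just below \<open>tri (Suc k)\<close> weigh \<open>2 ^ k\<close> each, and these blocks sum to
  \<open>(l - 1) * 2 ^ l + 1\<close>; from \<open>tri l\<close> on every weight is
  \<open>2 ^ l\<close>.\<close>

lemma sum_wt_lessThan:
  "tri l \<le> m \<Longrightarrow> sum (wt l) {..<m} = (int l - 1) * 2 ^ l + 1 + (int m - int (tri l)) * 2 ^ l"
proof (induction l arbitrary: m)
  case 0
  then show ?case by simp
next
  case (Suc l)
  have base: "sum (wt (Suc l)) {..<tri (Suc l)} = int l * 2 ^ Suc l + 1"
  proof -
    have "sum (wt (Suc l)) {..<tri (Suc l)} = sum (wt l) {..<tri (Suc l)}"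
      by (rule sum.cong) auto
    also have "\<dots> = (int l - 1) * 2 ^ l + 1 + int (Suc l) * 2 ^ l"
      using Suc.IH[of "tri (Suc l)"] by simp
    finally show ?thesis by (simp add: algebra_simps)
  qed
  have "{..<m} = {..<tri (Suc l)} \<union> {tri (Suc l)..<m}" using Suc.prems by auto
  then have "sum (wt (Suc l)) {..<m} = sum (wt (Suc l)) {..<tri (Suc l)} + sum (wt (Suc l)) {tri (Suc l)..<m}"
    by (metis finite_atLeastLessThan finite_lessThan ivl_disj_int_one(2) sum.union_disjoint)
  also have "sum (wt (Suc l)) {tri (Suc l)..<m} = (int m - int (tri (Suc l))) * 2 ^ Suc l"
    using Suc.prems by (subst sum_wt_eq) (auto simp: of_nat_diff)
  finally show ?case using base by simp
qed

lemma psi_mono: "finite B \<Longrightarrow> A \<subseteq> B \<Longrightarrow> psi l A \<le> psi l B"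
  using sum_wt_mono[of B A l] by (simp add: psi_def)

text \<open>The \<open>l\<close> full weights cancel the term \<open>- l * 2 ^ l\<close>. With one
  extra move, such a pile typically pays for the weight of one further disk.\<close>

lemma psi_many:
  assumes "finite E" "K \<subseteq> E" "\<And>e. e \<in> K \<Longrightarrow> tri l \<le> e" "l \<le> card K"
  shows "2 ^ l - 1 \<le> psi l E"
proof -
  have "int l * 2 ^ l \<le> int (card K) * 2 ^ l" using assms(4) by simp
  also have "\<dots> = sum (wt l) K" using assms(3) by (simp add: sum_wt_eq)
  also have "\<dots> \<le> sum (wt l) E" using assms by (simp add: sum_wt_mono)
  finally show ?thesis by (simp add: psi_def algebra_simps)
qed

lemma psi_empty_le: "psi l {} \<le> 0"
proof (cases l)
  case (Suc k)
  have "psi l {} = - (int k * (2 * 2 ^ k)) - 1" using Suc by (simp add: psi_def)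
  moreover have "(0::int) \<le> int k * (2 * 2 ^ k)" by simp
  ultimately show ?thesis by linarith
qed (simp add: psi_def)

lemma psi_insert: "finite E \<Longrightarrow> e \<notin> E \<Longrightarrow> psi l (insert e E) = psi l E + wt l e"
  by (simp add: psi_def)

lemma psi_Un: "finite A \<Longrightarrow> finite B \<Longrightarrow> A \<inter> B = {} \<Longrightarrow> psi l (A \<union> B) = psi l A + sum (wt l) B"
  by (simp add: psi_def sum.union_disjoint)

text \<open>The left side is the secant line of the convex function \<open>2 ^ k\<close> through
  \<open>k = l\<close> and \<open>k = l + 1\<close>. It compares a three-peg transfer with
  \<open>k\<close> weights \<open>2 ^ l\<close>.\<close>

lemma two_power_line: "(1 - int l) * 2 ^ l + int k * 2 ^ l \<le> 2 ^ k"
proof (cases "k < l")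
  case True
  then have "(1 - int l + int k) * 2 ^ l \<le> 0" by (intro mult_nonpos_nonneg) auto
  also have "\<dots> \<le> 2 ^ k" by simp
  finally show ?thesis by (simp add: algebra_simps)
next
  case False
  then obtain d where d: "k = l + d" using le_Suc_ex by (metis not_less)
  have "int d + 1 \<le> 2 ^ d" by (induction d) auto
  then have "(1 + int d) * 2 ^ l \<le> 2 ^ d * 2 ^ l" by (intro mult_right_mono) auto
  then show ?thesis by (simp add: d power_add algebra_simps)
qed

section \<open>Walks and move counts\<close>

definition moved :: "(nat \<Rightarrow> nat \<Rightarrow> nat) \<Rightarrow> nat \<Rightarrow> nat \<Rightarrow> bool" where
  "moved u t D \<longleftrightarrow> u (Suc t) D \<noteq> u t D"

text \<open>A finite path becomes a walk by resting in its last configuration forever and placing the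
  disks \<open>D \<ge> N\<close> on peg \<open>0\<close>.\<close>

definition walk :: "(nat \<Rightarrow> nat \<Rightarrow> nat) \<Rightarrow> bool" where
  "walk u \<longleftrightarrow> (\<forall>t D. u t D < 4) \<and>
     (\<forall>t D D'. moved u t D \<longrightarrow> D' \<noteq> D \<longrightarrow>
        \<not> moved u t D' \<and> (D' < D \<longrightarrow> u t D' \<noteq> u t D \<and> u t D' \<noteq> u (Suc t) D))"

text \<open>Times are counted, not pairs of a time and a disk. As a walk moves at most one disk per
  step, the count is still additive over disjoint sets of disks, and it is bounded by the
  duration.\<close>

definition mv :: "(nat \<Rightarrow> nat \<Rightarrow> nat) \<Rightarrow> nat set \<Rightarrow> nat \<Rightarrow> nat \<Rightarrow> nat" where
  "mv u S i j = card {t \<in> {i..<j}. \<exists>D\<in>S. moved u t D}"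

lemma walk_peg: "walk u \<Longrightarrow> u t D < 4"
  by (simp add: walk_def)

lemma walk_avoid:
  assumes "walk u" "moved u t D" "D' < D"
  shows "u t D' \<noteq> u t D" "u t D' \<noteq> u (Suc t) D" "u (Suc t) D' = u t D'"
  using assms unfolding walk_def by (auto simp: moved_def dest: less_imp_neq)

lemma walk_unique: "walk u \<Longrightarrow> moved u t D \<Longrightarrow> moved u t D' \<Longrightarrow> D' = D"
  unfolding walk_def by blast

lemma mv_split: "i \<le> k \<Longrightarrow> k \<le> j \<Longrightarrow> mv u S i j = mv u S i k + mv u S k j"
proof -
  assume "i \<le> k" "k \<le> j"
  then have "{t \<in> {i..<j}. \<exists>D\<in>S. moved u t D} =
      {t \<in> {i..<k}. \<exists>D\<in>S. moved u t D} \<union> {t \<in> {k..<j}. \<exists>D\<in>S. moved u t D}"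
    by auto
  then show ?thesis by (simp add: mv_def card_Un_disjoint disjoint_iff)
qed

lemma mv_Un:
  assumes "walk u" "A \<inter> B = {}"
  shows "mv u (A \<union> B) i j = mv u A i j + mv u B i j"
proof -
  have "{t \<in> {i..<j}. \<exists>D\<in>A \<union> B. moved u t D} =
      {t \<in> {i..<j}. \<exists>D\<in>A. moved u t D} \<union> {t \<in> {i..<j}. \<exists>D\<in>B. moved u t D}"
    by auto
  moreover have "{t \<in> {i..<j}. \<exists>D\<in>A. moved u t D} \<inter> {t \<in> {i..<j}. \<exists>D\<in>B. moved u t D} = {}"
    using assms walk_unique by blast
  ultimately show ?thesis by (simp add: mv_def card_Un_disjoint)
qed

lemma mv_mono: "A \<subseteq> B \<Longrightarrow> i' \<le> i \<Longrightarrow> j \<le> j' \<Longrightarrow> mv u A i j \<le> mv u B i' j'"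
  unfolding mv_def by (rule card_mono) auto

lemma mv_pos: "moved u t D \<Longrightarrow> D \<in> S \<Longrightarrow> i \<le> t \<Longrightarrow> t < j \<Longrightarrow> 1 \<le> mv u S i j"
proof -
  assume "moved u t D" "D \<in> S" "i \<le> t" "t < j"
  then have "{t} \<subseteq> {t \<in> {i..<j}. \<exists>D\<in>S. moved u t D}" by auto
  then have "card {t} \<le> mv u S i j" unfolding mv_def by (rule card_mono[rotated]) simp
  then show ?thesis by simp
qed

lemma mv_chain:
  "mv u S i k + mv u S k' j \<le> mv u S i j" if "i \<le> k" "k \<le> k'" "k' \<le> j"
  using that mv_split[of i k j u S] mv_mono[of S S k k' j j u] by simp

lemma mv_Un_le:
  assumes "walk u" "A \<inter> B = {}" "A \<union> B \<subseteq> C"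
  shows "mv u A i j + mv u B i j \<le> mv u C i j"
  using mv_Un[OF assms(1,2), of i j] mv_mono[OF assms(3) order_refl order_refl, of u i j] by simp

lemma mv_each:
  assumes "walk u" "finite S" "\<And>D. D \<in> S \<Longrightarrow> \<exists>t. i \<le> t \<and> t < j \<and> moved u t D"
  shows "card S \<le> mv u S i j"
proof -
  obtain f where f: "\<And>D. D \<in> S \<Longrightarrow> i \<le> f D \<and> f D < j \<and> moved u (f D) D"
    using assms(3) by metis
  have "inj_on f S"
    using f walk_unique[OF assms(1)] by (metis inj_onI)
  moreover have "f ` S \<subseteq> {t \<in> {i..<j}. \<exists>D\<in>S. moved u t D}" using f by fastforce
  ultimately show ?thesis unfolding mv_def
    using card_mono[of "{t \<in> {i..<j}. \<exists>D\<in>S. moved u t D}" "f ` S"] by (simp add: card_image)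
qed

section \<open>First and last crossing times\<close>

lemma first_crossing:
  fixes i j :: nat
  assumes "i \<le> j" "P i" "\<not> P j"
  obtains t where "i \<le> t" "t < j" "P t" "\<not> P (Suc t)" "\<And>t'. i \<le> t' \<Longrightarrow> t' \<le> t \<Longrightarrow> P t'"
proof -
  define m where "m = (LEAST t. i \<le> t \<and> \<not> P t)"
  have m: "i \<le> m" "\<not> P m" using LeastI[of "\<lambda>t. i \<le> t \<and> \<not> P t" j] assms by (auto simp: m_def)
  have le: "m \<le> j" using Least_le[of "\<lambda>t. i \<le> t \<and> \<not> P t" j] assms by (auto simp: m_def)
  have below: "P t'" if "i \<le> t'" "t' < m" for t'
    using not_less_Least[of t' "\<lambda>t. i \<le> t \<and> \<not> P t"] that by (auto simp: m_def)
  have "m \<noteq> i" using m assms by metis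
  then obtain t where t: "m = Suc t" using m(1) by (cases m) auto
  show ?thesis
    by (rule that[of t]) (use m le below \<open>m \<noteq> i\<close> in \<open>auto simp: t\<close>)
qed

lemma last_crossing:
  fixes i j :: nat
  assumes "i \<le> j" "P i" "\<not> P j"
  obtains t where "i \<le> t" "t < j" "P t" "\<not> P (Suc t)" "\<And>t'. Suc t \<le> t' \<Longrightarrow> t' \<le> j \<Longrightarrow> \<not> P t'"
proof -
  obtain s where s: "0 \<le> s" "s < j - i" "\<not> P (j - s)" "\<not> \<not> P (j - Suc s)"
      "\<And>t'. 0 \<le> t' \<Longrightarrow> t' \<le> s \<Longrightarrow> \<not> P (j - t')"
    by (rule first_crossing[of 0 "j - i" "\<lambda>t. \<not> P (j - t)"]) (use assms in auto)
  show ?thesis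
  proof (rule that[of "j - Suc s"])
    show "\<not> P t'" if "Suc (j - Suc s) \<le> t'" "t' \<le> j" for t'
      using s(5)[of "j - t'"] that s(2) by (auto simp: Suc_diff_Suc)
  qed (use s in \<open>auto simp: Suc_diff_Suc\<close>)
qed

lemma first_leave:
  assumes "i \<le> j" "u i D = a" "u j D \<noteq> a"
  obtains t where "i \<le> t" "t < j" "u t D = a" "u (Suc t) D \<noteq> a" "moved u t D"
    "\<And>t'. i \<le> t' \<Longrightarrow> t' \<le> t \<Longrightarrow> u t' D = a"
  by (rule first_crossing[of i j "\<lambda>t. u t D = a"]) (use assms in \<open>auto simp: moved_def\<close>)

lemma last_enter:
  assumes "i \<le> j" "u i D \<noteq> a" "u j D = a"
  obtains t where "i \<le> t" "t < j" "u t D \<noteq> a" "u (Suc t) D = a" "moved u t D"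
    "\<And>t'. Suc t \<le> t' \<Longrightarrow> t' \<le> j \<Longrightarrow> u t' D = a"
  by (rule last_crossing[of i j "\<lambda>t. u t D \<noteq> a"]) (use assms in \<open>auto simp: moved_def\<close>)

text \<open>A disk may shuttle between two pegs that have to be cleared. Only its last departure
  from the pair ends outside, which confines the smaller disks to one peg of the pair and one
  outside peg.\<close>

lemma last_exit:
  assumes "i \<le> j" "u i D \<in> A" "u j D \<notin> A"
  obtains t where "i \<le> t" "t < j" "u t D \<in> A" "u (Suc t) D \<notin> A" "moved u t D"
proof -
  obtain t where t: "i \<le> t" "t < j" "u t D \<in> A" "u (Suc t) D \<notin> A"
    by (rule last_crossing[of i j "\<lambda>t. u t D \<in> A"]) (use assms in auto)
  then have "moved u t D" by (auto simp: moved_def)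
  with t show ?thesis by (rule that)
qed

section \<open>Pigeonhole on four pegs\<close>

lemma four_pegs:
  fixes a b c d x :: nat
  assumes "a < 4" "b < 4" "c < 4" "d < 4" "distinct [a, b, c, d]" "x < 4"
  shows "x = a \<or> x = b \<or> x = c \<or> x = d"
proof -
  have "card {a, b, c, d} = 4" using assms(5) by simp
  moreover have "{a, b, c, d} \<subseteq> {..<4}" using assms by auto
  ultimately have "{a, b, c, d} = {..<4}" by (intro card_subset_eq) auto
  then show ?thesis using assms(6) by blast
qed

lemma fourth_peg:
  fixes a b c d x :: nat
  assumes "a < 4" "b < 4" "c < 4" "d < 4" "x < 4" "distinct [a, b, c, d]" "x \<noteq> a" "x \<noteq> b" "x \<noteq> c"
  shows "x = d"
  using four_pegs[OF assms(1-4,6,5)] assms(7-9) by blast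

lemma other_peg:
  fixes a b c :: nat
  assumes "a < 4" "b < 4" "c < 4"
  obtains d where "d < 4" "d \<noteq> a" "d \<noteq> b" "d \<noteq> c"
proof -
  have "card {a, b, c} \<le> 3" by (simp add: card_insert_if)
  then have "\<not> {..<4} \<subseteq> {a, b, c}"
    using card_mono[of "{a, b, c}" "{..<4::nat}"] by auto
  then show ?thesis using that by blast
qed

section \<open>Time reversal\<close>

definition rev_walk :: "nat \<Rightarrow> (nat \<Rightarrow> nat \<Rightarrow> nat) \<Rightarrow> nat \<Rightarrow> nat \<Rightarrow> nat" where
  "rev_walk T u = (\<lambda>t. u (T - t))"

text \<open>Truncated subtraction makes the reversed walk rest in \<open>u 0\<close> from time
  \<open>T\<close> on, so it is again an infinite walk and moves only before
  \<open>T\<close>.\<close>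

lemma moved_rev: "moved (rev_walk T u) t D \<longleftrightarrow> t < T \<and> moved u (T - Suc t) D"
  by (cases "t < T") (auto simp: moved_def rev_walk_def Suc_diff_Suc)

lemma walk_rev:
  assumes "walk u"
  shows "walk (rev_walk T u)"
  unfolding walk_def
proof (intro conjI allI impI)
  show "rev_walk T u t D < 4" for t D using assms by (simp add: rev_walk_def walk_peg)
next
  fix t D D' assume m: "moved (rev_walk T u) t D" and ne: "D' \<noteq> D"
  then have t: "t < T" and m': "moved u (T - Suc t) D" by (auto simp: moved_rev)
  show "\<not> moved (rev_walk T u) t D'" using walk_unique[OF assms m'] ne by (auto simp: moved_rev)
  assume "D' < D"
  from walk_avoid[OF assms m' this] t
  show "rev_walk T u t D' \<noteq> rev_walk T u t D" "rev_walk T u t D' \<noteq> rev_walk T u (Suc t) D"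
    by (auto simp: rev_walk_def Suc_diff_Suc)
qed

lemma mv_rev:
  assumes "i \<le> j" "j \<le> T"
  shows "mv (rev_walk T u) S (T - j) (T - i) = mv u S i j"
proof -
  have "{t \<in> {i..<j}. \<exists>D\<in>S. moved u t D} =
      (\<lambda>t. T - Suc t) ` {t \<in> {T - j..<T - i}. \<exists>D\<in>S. moved (rev_walk T u) t D}" (is "?A = ?f ` ?B")
  proof (intro equalityI subsetI)
    fix t assume "t \<in> ?A"
    then have "T - Suc t \<in> ?B" "?f (T - Suc t) = t" using assms by (auto simp: moved_rev)
    then show "t \<in> ?f ` ?B" by (intro image_eqI[of _ _ "T - Suc t"]) simp_all
  qed (use assms in \<open>auto simp: moved_rev\<close>)
  moreover have "inj_on ?f ?B" by (rule inj_onI) auto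
  ultimately show ?thesis by (simp add: mv_def card_image)
qed

section \<open>Larger disks confined by a resting disk\<close>

lemma blocked:
  assumes w: "walk u" and b: "\<And>t. i \<le> t \<Longrightarrow> t \<le> j \<Longrightarrow> u t b = p" "b < D"
    and D: "u i D \<noteq> p" and t: "i \<le> t" "t \<le> j"
  shows "u t D \<noteq> p"
proof
  assume "u t D = p"
  then obtain s where s: "i \<le> s" "s < t" "u (Suc s) D = p" and m: "moved u s D"
    using t(1) D last_enter[of i t u D p] by metis
  have "u s b = p" using s t by (intro b(1)) simp_all
  then show False using walk_avoid(2)[OF w m b(2)] s(3) by simp
qed

text \<open>The resting disk \<open>b\<close> confines the larger disks to three pegs.\<close>

lemma stack_moves:
  assumes w: "walk u" and "finite S" "i \<le> j"
    and b: "\<And>t. i \<le> t \<Longrightarrow> t \<le> j \<Longrightarrow> u t b = p" "\<And>D. D \<in> S \<Longrightarrow> b < D"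
    and S: "\<And>D. D \<in> S \<Longrightarrow> u i D = v" "\<And>D. D \<in> S \<Longrightarrow> u j D = z"
    and pegs: "p \<noteq> v" "v \<noteq> z"
  shows "2 ^ card S \<le> mv u S i j + 1"
  using assms(2-)
proof (induction "card S" arbitrary: S i j v z)
  case 0
  then show ?case by simp
next
  case (Suc k)
  have "S \<noteq> {}" using Suc.hyps(2) by auto
  define g where "g = Max S"
  have g: "g \<in> S" using \<open>S \<noteq> {}\<close> \<open>finite S\<close> by (simp add: g_def)
  define S' where "S' = S - {g}"
  have S': "finite S'" "card S' = k" "S = insert g S'" "g \<notin> S'" "\<And>D. D \<in> S' \<Longrightarrow> D < g"
    using Suc.hyps(2) \<open>finite S\<close> g by (auto simp: S'_def g_def order.strict_iff_order)
  have up: "u t D \<noteq> p" if "i \<le> t" "t \<le> j" "D \<in> S" for t D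
    using blocked[OF w, of i j b p D t] that Suc.prems(3-5,7) by metis
  obtain t1 where t1: "i \<le> t1" "t1 < j" "u t1 g = v" "u (Suc t1) g \<noteq> v" and m1: "moved u t1 g"
    by (rule first_leave[of i j u g v]) (use Suc.prems(2,5,6,8) g in auto)
  obtain t2 where t2: "t1 \<le> t2" "t2 < j" "u t2 g \<noteq> z" "u (Suc t2) g = z" and m2: "moved u t2 g"
    by (rule last_enter[of t1 j u g z]) (use Suc.prems(6,8) g t1 in auto)
  have peg: "v < 4" "z < 4" "p < 4" "u t D < 4" for t D
    using walk_peg[OF w, of i g] walk_peg[OF w, of j g] walk_peg[OF w, of i b] walk_peg[OF w]
      Suc.prems(5,6)[OF g] Suc.prems(3)[of i] Suc.prems(2) by simp_all
  \<comment> \<open>When \<open>g\<close> moves, the smaller disks of \<open>S\<close> avoid both of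
    its pegs and \<open>p\<close>, so they form one tower: on \<open>r1\<close> at the first
    departure of \<open>g\<close>, on \<open>r2\<close> at its last arrival. Each of the two
    transfers is handled by the induction hypothesis.\<close>
  obtain r1 where r1: "r1 < 4" "r1 \<noteq> v" "r1 \<noteq> u (Suc t1) g" "r1 \<noteq> p"
    by (rule other_peg[of v "u (Suc t1) g" p]) (use peg in auto)
  obtain r2 where r2: "r2 < 4" "r2 \<noteq> z" "r2 \<noteq> u t2 g" "r2 \<noteq> p"
    by (rule other_peg[of z "u t2 g" p]) (use peg in auto)
  have np: "u (Suc t1) g \<noteq> p" "u t2 g \<noteq> p" "z \<noteq> p"
    using up[OF _ _ g, of "Suc t1"] up[OF _ _ g, of t2] up[OF _ _ g, of j] Suc.prems(2) Suc.prems(6)[OF g] t1(1,2) t2(1,2)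
    by simp_all
  have at1: "u t1 D = r1" if "D \<in> S'" for D
  proof (rule fourth_peg[of v "u (Suc t1) g" p])
    show "u t1 D \<noteq> v" "u t1 D \<noteq> u (Suc t1) g"
      using walk_avoid[OF w m1 S'(5)[OF that]] t1(3) by simp_all
    show "u t1 D \<noteq> p" using up[of t1 D] that S'(3) t1 by simp
    show "distinct [v, u (Suc t1) g, p, r1]" using r1 t1 np Suc.prems(7) by simp
  qed (use peg r1 in simp_all)
  have at2: "u t2 D = r2" "u (Suc t2) D = r2" if "D \<in> S'" for D
  proof -
    show "u t2 D = r2"
    proof (rule fourth_peg[of z "u t2 g" p])
      show "u t2 D \<noteq> z" "u t2 D \<noteq> u t2 g"
        using walk_avoid[OF w m2 S'(5)[OF that]] t2(4) by simp_all
      show "u t2 D \<noteq> p" using up[of t2 D] that S'(3) t1 t2 by simp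
      show "distinct [z, u t2 g, p, r2]" using r2 t2 np by simp
    qed (use peg r2 in simp_all)
    then show "u (Suc t2) D = r2" using walk_avoid(3)[OF w m2 S'(5)[OF that]] by simp
  qed
  have "2 ^ card S' \<le> mv u S' i t1 + 1"
  proof (rule Suc.hyps(1)[OF S'(2)[symmetric] S'(1) t1(1)])
    show "u t b = p" if "i \<le> t" "t \<le> t1" for t using that t1 by (intro Suc.prems(3)) simp_all
    show "u i D = v" if "D \<in> S'" for D using that S' Suc.prems(5) by simp
    show "b < D" if "D \<in> S'" for D using that S' Suc.prems(4) by simp
    show "u t1 D = r1" if "D \<in> S'" for D by (rule at1[OF that])
  qed (use Suc.prems(7) r1 in simp_all)
  moreover have "2 ^ card S' \<le> mv u S' (Suc t2) j + 1"
  proof (rule Suc.hyps(1)[OF S'(2)[symmetric] S'(1)])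
    show "u t b = p" if "Suc t2 \<le> t" "t \<le> j" for t using that t1 t2 by (intro Suc.prems(3)) simp_all
    show "u j D = z" if "D \<in> S'" for D using that S' Suc.prems(6) by simp
    show "b < D" if "D \<in> S'" for D using that S' Suc.prems(4) by simp
    show "u (Suc t2) D = r2" if "D \<in> S'" for D by (rule at2[OF that])
  qed (use r2 t2 in simp_all)
  moreover have "mv u S' i t1 + mv u S' (Suc t2) j \<le> mv u S' i j"
    using t1 t2 by (intro mv_chain) auto
  moreover have "mv u S' i j + mv u {g} i j \<le> mv u S i j"
    by (rule mv_Un_le[OF w]) (use g in \<open>auto simp: S'_def\<close>)
  moreover have "1 \<le> mv u {g} i j" by (rule mv_pos[OF m1]) (use t1 in auto)
  moreover have "(2::nat) ^ card S = 2 * 2 ^ card S'"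
    unfolding S'(2) Suc.hyps(2)[symmetric] by simp
  ultimately show ?case by linarith
qed

definition avoids :: "(nat \<Rightarrow> nat \<Rightarrow> nat) \<Rightarrow> nat \<Rightarrow> nat \<Rightarrow> nat \<Rightarrow> bool" where
  "avoids u t n a \<longleftrightarrow> (\<forall>D<n. u t D \<noteq> a)"

definition part :: "(nat \<Rightarrow> nat \<Rightarrow> nat) \<Rightarrow> nat \<Rightarrow> nat \<Rightarrow> nat \<Rightarrow> nat set" where
  "part u t n a = {D. D < n \<and> u t D = a}"

lemma finite_part [simp]: "finite (part u t n a)"
  by (simp add: part_def)

lemma move_avoids:
  assumes "walk u" "moved u t D"
  shows "avoids u t D (u t D)" "avoids u t D (u (Suc t) D)"
    "avoids u (Suc t) D (u t D)" "avoids u (Suc t) D (u (Suc t) D)"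
  using walk_avoid[OF assms] by (auto simp: avoids_def)

lemma avoids_le: "avoids u t n a \<Longrightarrow> m \<le> n \<Longrightarrow> avoids u t m a"
  by (auto simp: avoids_def)

lemma part_move:
  assumes "walk u" "moved u t D" "n \<le> D"
  shows "part u (Suc t) n a = part u t n a"
  using walk_avoid(3)[OF assms(1,2)] assms(3) by (auto simp: part_def)

section \<open>Clearing and filling a peg\<close>

lemma rev_walk_apply: "rev_walk T u t = u (T - t)"
  by (simp add: rev_walk_def)

text \<open>Induction on \<open>n\<close>, then on \<open>l\<close>. When the largest disk \<open>g\<close> leaves \<open>{a, b}\<close> for the last time
  \<open>r\<close>, the smaller disks sit on two pegs \<open>s'\<close> and \<open>z\<close>; the part \<open>X\<close> on \<open>s'\<close> still has to be cleared,
  whereas the part on \<open>z\<close> has been built up before \<open>r\<close>. The largest relevant disk \<open>n'\<close> on \<open>z\<close>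
  separates these contributions, and from its arrival at \<open>b'\<close> on it blocks \<open>z\<close> for the larger
  disks.\<close>

lemma clear_lower:
  assumes "walk u" "i \<le> j" "a \<noteq> b" "a < 4" "b < 4" "avoids u j n a" "avoids u j n b"
  shows "psi l (part u i n a) \<le> int (mv u {..<n} i j)"
  using assms
proof (induction n arbitrary: u i j a b l rule: less_induct)
  case (less n)
  \<comment> \<open>The induction hypothesis read backwards in time: filling a peg is needed inside
    this induction.\<close>
  have rev: "psi l (part u j m a) \<le> int (mv u {..<m} i j)"
    if "m < n" "walk u" "i \<le> j" "a \<noteq> b" "a < 4" "b < 4" "avoids u i m a" "avoids u i m b"
    for m u i j a b l
  proof -
    have "psi l (part (rev_walk j u) 0 m a) \<le> int (mv (rev_walk j u) {..<m} 0 (j - i))"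
      using that walk_rev[OF that(2), of j, unfolded rev_walk_def]
      by (intro less.IH[of m "rev_walk j u" 0 "j - i" a b]) (auto simp: avoids_def rev_walk_def)
    moreover have "part (rev_walk j u) 0 m a = part u j m a" by (simp add: part_def rev_walk_apply)
    ultimately show ?thesis using mv_rev[of i j j u "{..<m}"] that by simp
  qed
  note w = less.prems(1)
  show ?case
  proof (cases n)
    case 0
    have "part u i n a = {}" by (simp add: part_def 0)
    then show ?thesis using psi_empty_le[of l] by simp
  next
    case n: (Suc g)
    have mono: "mv u {..<g} i j \<le> mv u {..<n} i j" by (rule mv_mono) (auto simp: n)
    show ?thesis
    proof (cases "u i g = a")
      case False
      then have "part u i n a = part u i g a" using less_Suc_eq by (auto simp: part_def n)
      moreover have "psi l (part u i g a) \<le> int (mv u {..<g} i j)"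
        using less.prems by (intro less.IH[of g _ _ _ a b]) (auto simp: n avoids_def)
      ultimately show ?thesis using mono by simp
    next
      case ga: True
      define E where "E = part u i n a"
      define E' where "E' = part u i g a"
      have fin: "finite E" "finite E'" by (simp_all add: E_def E'_def)
      have E: "E = insert g E'" "g \<notin> E'" using ga less_Suc_eq by (auto simp: E_def E'_def part_def n)
      have E'g: "e < g" if "e \<in> E'" for e using that by (simp add: E'_def part_def)
      have "u j g \<notin> {a, b}" using less.prems(6,7) by (simp add: avoids_def n)
      then obtain r where r: "i \<le> r" "r < j" "u r g \<in> {a, b}" "u (Suc r) g \<notin> {a, b}" and mr: "moved u r g"
        using last_exit[of i j u g "{a, b}"] ga less.prems(2) by blast
      define s' where "s' = (if u r g = a then b else a)"
      define e where "e = u (Suc r) g"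
      obtain z where z: "z < 4" "z \<noteq> a" "z \<noteq> b" "z \<noteq> e"
        by (rule other_peg[of a b e]) (use less.prems w in \<open>auto simp: e_def walk_peg\<close>)
      have at_r: "u r D = s' \<or> u r D = z" if "D < g" for D
      proof -
        have "u r D \<noteq> u r g" "u r D \<noteq> e" using walk_avoid[OF w mr that] by (simp_all add: e_def)
        moreover have "distinct [a, b, e, z]" using z r less.prems(3) by (auto simp: e_def)
        then have "u r D = a \<or> u r D = b \<or> u r D = e \<or> u r D = z"
          using z(1) less.prems(4,5) walk_peg[OF w] by (intro four_pegs) (auto simp: e_def)
        ultimately show ?thesis using r(3) by (auto simp: s'_def)
      qed
      define X where "X = part u r g s'"
      have finX: "finite X" by (simp add: X_def)
      obtain r1 where r1: "i \<le> r1" "r1 < Suc r" "u r1 g = a" "u (Suc r1) g \<noteq> a" and mr1: "moved u r1 g"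
          and const1: "\<And>t. i \<le> t \<Longrightarrow> t \<le> r1 \<Longrightarrow> u t g = a"
        by (rule first_leave[of i "Suc r" u g a]) (use r ga in auto)
      have before: "psi l E' \<le> int (mv u {..<g} i r1)" for l
        unfolding E'_def
        using move_avoids[OF w mr1] r1 less.prems(4) n w
        by (intro less.IH[of g _ _ _ a "u (Suc r1) g"]) (auto simp: walk_peg)
      have after: "psi l X \<le> int (mv u {..<g} (Suc r) j)" for l
      proof -
        have "psi l (part u (Suc r) g s') \<le> int (mv u {..<g} (Suc r) j)"
          using less.prems r w n
          by (intro less.IH[of g _ _ _ s' "if s' = a then b else a"]) (auto simp: s'_def avoids_def)
        then show ?thesis using part_move[OF w mr order_refl] by (simp add: X_def)
      qed
      have nUn: "mv u {..<n} i j = mv u {..<g} i j + mv u {g} i j"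
      proof -
        have "{..<n} = {..<g} \<union> {g}" by (auto simp: n)
        then show ?thesis using mv_Un[OF w, of "{..<g}" "{g}"] by simp
      qed
      have g1: "1 \<le> mv u {g} i j" by (rule mv_pos[OF mr]) (use r in auto)
      have direct: "psi l1 E' + 1 + psi l2 X \<le> int (mv u {..<n} i j)" for l1 l2
        using before[of l1] after[of l2] mv_chain[of i r1 "Suc r" j u "{..<g}"] r1 r nUn g1 by simp
      have psiE: "psi l E = psi l E' + wt l g" for l
        using psi_insert[OF fin(2) E(2)] E(1) by simp
      show ?thesis
        unfolding E_def[symmetric]
      proof (induction l)
        case 0
        show ?case using direct[of 0 0] psiE[of 0] by (simp add: psi_def)
      next
        case (Suc k)
        let ?P = "2 ^ k :: int"
        define c where "c = card {e \<in> E. tri (Suc k) \<le> e}"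
        have psi_c: "psi (Suc k) E = psi k E + (int c - int (Suc k)) * ?P"
          using psi_Suc[OF fin(1)] by (simp only: c_def)
        show ?case
        proof (cases "c \<le> k")
          case True
          then have "(int c - int (Suc k)) * ?P \<le> 0" by (intro mult_nonpos_nonneg) auto
          then show ?thesis using psi_c Suc.IH by simp
        next
          case False
          then have ck: "Suc k \<le> c" by simp
          have "{e \<in> E. tri (Suc k) \<le> e} \<noteq> {}" using ck c_def by (metis card.empty not_less_eq_eq le0)
          then have trig: "tri (Suc k) \<le> g" using E E'g by (force dest: less_imp_le)
          define K where "K = {e \<in> E'. tri (Suc k) \<le> e}"
          have "{e \<in> E. tri (Suc k) \<le> e} = insert g K" using E trig by (auto simp: K_def)
          then have cK: "c = Suc (card K)" using fin E by (simp add: c_def K_def)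
          have wtg: "wt (Suc k) g = 2 * ?P" "wt k g = ?P"
            using wt_eq[OF trig] wt_eq[of k g] trig tri_mono[of k "Suc k"] by simp_all
          show ?thesis
          \<comment> \<open>If all heavy disks of \<open>E'\<close> are in \<open>X\<close>, they
            still have to be cleared after \<open>r\<close>, and this together with the move of
            \<open>g\<close> pays for the weight of \<open>g\<close>. Otherwise some heavy disk was
            put on \<open>z\<close> before \<open>r\<close>.\<close>
          proof (cases "K \<subseteq> X")
            case True
            show ?thesis
            proof (cases "c = Suc k")
              case c: True
              have "?P - 1 \<le> psi k X"
                using True cK c tri_mono[of k "Suc k"] finX
                by (intro psi_many[of X K]) (auto simp: K_def)
              then show ?thesis using direct[of k k] psi_c psiE[of k] wtg c by simp
            next
              case False
              have "2 ^ Suc k - 1 \<le> psi (Suc k) X"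
                using True cK ck False finX by (intro psi_many[of X K]) (auto simp: K_def)
              then show ?thesis using direct[of "Suc k" "Suc k"] psiE[of "Suc k"] wtg by simp
            qed
          next
            case False
            define n' where "n' = Max (K - X)"
            have "finite K" using fin by (simp add: K_def)
            then have n'K: "n' \<in> K - X" using False unfolding n'_def by (intro Max_in) auto
            have n'max: "e \<le> n'" if "e \<in> K" "e \<notin> X" for e
              unfolding n'_def using that \<open>finite K\<close> by (intro Max_ge) auto
            have n': "n' \<in> E'" "tri (Suc k) \<le> n'" "n' < g" "u i n' = a" "u r n' = z"
            proof -
              show 1: "n' \<in> E'" "tri (Suc k) \<le> n'" using n'K by (simp_all add: K_def)
              show 2: "n' < g" by (rule E'g[OF 1(1)])
              show "u i n' = a" using 1 by (simp add: E'_def part_def)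
              show "u r n' = z" using at_r[OF 2] 2 n'K by (auto simp: X_def part_def)
            qed
            define A where "A = {e \<in> E'. n' < e}"
            have AX: "A \<subseteq> X" and AK: "A \<subseteq> K" and finA: "finite A"
              using n'max n'(2) fin by (force simp: A_def K_def)+
            obtain b' where b': "i \<le> b'" "b' < r" "u b' n' \<noteq> z" "u (Suc b') n' = z" and mb: "moved u b' n'"
                and constb: "\<And>t. Suc b' \<le> t \<Longrightarrow> t \<le> r \<Longrightarrow> u t n' = z"
              by (rule last_enter[of i r u n' z]) (use r n' z in auto)
            \<comment> \<open>\<open>L\<close> collects the disks from \<open>n'\<close> upwards
              that have left \<open>a\<close> by the time \<open>n'\<close> lands on
              \<open>z\<close>. Its maximum \<open>e1\<close> splits \<open>insert n' A\<close>: the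
              disks in \<open>B\<close> are paid by clearing \<open>a\<close> for the departure of
              \<open>e1\<close>, those in \<open>A2\<close> still wait on \<open>a\<close> and then
              find \<open>z\<close> blocked.\<close>
            define L where "L = {e \<in> insert n' A. \<exists>t. i \<le> t \<and> t \<le> Suc b' \<and> u t e \<noteq> a}"
            have n'L: "n' \<in> L" using b' z by (auto simp: L_def intro!: exI[of _ "Suc b'"])
            have finL: "finite L" using finA by (simp add: L_def)
            define e1 where "e1 = Max L"
            have e1L: "e1 \<in> L" using n'L finL unfolding e1_def by (intro Max_in) auto
            have e1max: "e \<le> e1" if "e \<in> L" for e using that finL by (simp add: e1_def)
            have e1: "n' \<le> e1" "e1 < g" "u i e1 = a"
              using e1L e1max n'L n' by (auto simp: L_def A_def E'_def part_def)
            obtain t1 where t1: "i \<le> t1" "t1 \<le> Suc b'" "u t1 e1 \<noteq> a" using e1L by (auto simp: L_def)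
            obtain a1 where a1: "i \<le> a1" "a1 < t1" "u a1 e1 = a" "u (Suc a1) e1 \<noteq> a" and ma1: "moved u a1 e1"
              by (rule first_leave[of i t1 u e1 a]) (use t1 e1 in auto)
            define B where "B = {e \<in> insert n' A. e < e1}"
            define A2 where "A2 = {e \<in> A. e1 < e}"
            have finB: "finite B" and finA2: "finite A2" using finA by (auto simp: B_def A2_def)
            have partition: "insert n' A = insert e1 (B \<union> A2)"
              using e1L e1 by (auto simp: B_def A2_def L_def)
            have "card (insert n' A) = Suc (card (B \<union> A2))"
              unfolding partition using finB finA2 by (intro card_insert_disjoint) (auto simp: B_def A2_def)
            moreover have "card (B \<union> A2) = card B + card A2"
              using finB finA2 by (intro card_Un_disjoint) (auto simp: B_def A2_def)
            moreover have "card (insert n' A) = Suc (card A)" using finA by (simp add: A_def)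
            ultimately have cards: "card A = card B + card A2" by simp
            have bigK: "tri (Suc k) \<le> e \<and> tri k \<le> e" if "e \<in> insert n' A" for e
              using that n'K AK tri_mono[of k "Suc k"] by (auto simp: K_def)
            have "psi k (part u i e1 a) \<le> int (mv u {..<e1} i a1)"
              using move_avoids[OF w ma1] a1 less.prems(4) n w e1
              by (intro less.IH[of e1 _ _ _ a "u (Suc a1) e1"]) (auto simp: walk_peg)
            moreover have "part u i e1 a = part u i n' a \<union> B"
              using e1 n' by (auto simp: part_def B_def A_def E'_def)
            moreover have "part u i n' a \<inter> B = {}" by (auto simp: part_def B_def A_def)
            ultimately have c1: "psi k (part u i n' a) + int (card B) * ?P \<le> int (mv u {..<e1} i a1)"
              using psi_Un[of "part u i n' a" B k] finB sum_wt_eq[of B k] bigK by (auto simp: B_def)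
            have c2: "1 \<le> mv u {n'} b' (Suc b')" by (rule mv_pos[OF mb]) auto
            have c3: "psi k (part u r n' z) \<le> int (mv u {..<n'} (Suc b') r)"
              using move_avoids[OF w mb] b' n' n w z
              by (intro rev[of n' _ _ _ z "u b' n'"]) (auto simp: walk_peg)
            \<comment> \<open>The disks of \<open>A2\<close> leave \<open>a\<close> before
              \<open>g\<close> does, and when \<open>g\<close> first leaves they form a tower on
              \<open>x\<close>; with \<open>n'\<close> resting on \<open>z\<close> this is a
              three-peg transfer.\<close>
            have c4: "2 ^ card A2 \<le> mv u A2 (Suc b') r + 1"
            proof (cases "A2 = {}")
              case True then show ?thesis by simp
            next
              case False
              have still: "u t e = a" if "e \<in> A2" "i \<le> t" "t \<le> Suc b'" for e t
                using e1max[of e] that by (auto simp: L_def A2_def)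
              have A2g: "e < g" "n' < e" if "e \<in> A2" for e using that E'g by (auto simp: A2_def A_def)
              obtain e0 where e0: "e0 \<in> A2" using False by auto
              have "u r1 e0 \<noteq> a" using walk_avoid(1)[OF w mr1 A2g(1)[OF e0]] r1(3) by simp
              then have r1b: "Suc b' \<le> r1" using still[OF e0, of r1] r1(1) by (meson not_less_eq_eq nat_le_linear)
              have n'r1: "u r1 n' = z" using constb r1b r1 by simp
              define y where "y = u (Suc r1) g"
              have y: "y \<noteq> a" "y \<noteq> z" "y < 4"
                using r1 walk_avoid(2)[OF w mr1 n'(3)] n'r1 walk_peg[OF w] by (auto simp: y_def)
              obtain x where x: "x < 4" "x \<noteq> a" "x \<noteq> y" "x \<noteq> z"
                by (rule other_peg[of a y z]) (use y z less.prems in auto)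
              have "2 ^ card A2 \<le> mv u A2 (Suc b') r1 + 1"
              proof (rule stack_moves[OF w finA2 r1b])
                show "u t n' = z" if "Suc b' \<le> t" "t \<le> r1" for t using constb that r1 by simp
                show "n' < D" if "D \<in> A2" for D using A2g that by simp
                show "u (Suc b') D = a" if "D \<in> A2" for D using still[OF that, of "Suc b'"] b' by simp
                show "u r1 D = x" if D: "D \<in> A2" for D
                proof (rule fourth_peg[of a y z])
                  show "u r1 D \<noteq> a" "u r1 D \<noteq> y"
                    using walk_avoid[OF w mr1 A2g(1)[OF D]] r1(3) by (simp_all add: y_def)
                  show "u r1 D \<noteq> z"
                  proof (rule blocked[OF w, of "Suc b'" r1 n' z])
                    show "u t n' = z" if "Suc b' \<le> t" "t \<le> r1" for t using constb that r1 by simp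
                    show "u (Suc b') D \<noteq> z" using still[OF D, of "Suc b'"] b' z by simp
                  qed (use r1b A2g[OF D] in auto)
                  show "distinct [a, y, z, x]" using x y z by auto
                qed (use y z x less.prems walk_peg[OF w] in auto)
              qed (use z x in auto)
              also have "mv u A2 (Suc b') r1 \<le> mv u A2 (Suc b') r" using r1 by (intro mv_mono) auto
              finally show ?thesis by simp
            qed
            have c4': "2 ^ card A2 \<le> int (mv u A2 (Suc b') r) + 1"
              using iffD2[OF of_nat_le_iff[where 'a = int] c4] by simp
            have c34: "mv u {..<n'} (Suc b') r + mv u A2 (Suc b') r \<le> mv u {..<g} (Suc b') r"
            proof (rule mv_Un_le[OF w])
              show "{..<n'} \<inter> A2 = {}" by (auto simp: A2_def A_def)
              show "{..<n'} \<union> A2 \<subseteq> {..<g}"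
                using E'g less_imp_le[OF n'(3)] by (auto simp: A2_def A_def)
            qed
            have c12: "mv u {..<e1} i a1 \<le> mv u {..<g} i b'" "mv u {n'} b' (Suc b') \<le> mv u {..<g} b' (Suc b')"
              using e1(2) n'(3) a1(2) t1(2) by (auto intro!: mv_mono)
            have "mv u {..<g} i r = mv u {..<g} i b' + mv u {..<g} b' (Suc b') + mv u {..<g} (Suc b') r"
              using b' mv_split[of i b' r u] mv_split[of b' "Suc b'" r u] by simp
            then have total: "psi k (part u i n' a) + int (card B) * ?P + 1 + psi k (part u r n' z)
                + (2 ^ card A2 - 1) + 1 + psi k X \<le> int (mv u {..<n} i j)"
              using c1 c2 c3 c4' c34 c12 after[of k] mv_chain[of i r "Suc r" j u "{..<g}"] r(1,2) nUn g1
              by linarith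
            have psi_n': "psi k E = psi k (part u i n' a) + (int (card A) + 2) * ?P"
            proof -
              have "E' = part u i n' a \<union> insert n' A"
                using n' by (auto simp: E'_def part_def A_def)
              moreover have "part u i n' a \<inter> insert n' A = {}" by (auto simp: part_def A_def)
              ultimately have "psi k E' = psi k (part u i n' a) + sum (wt k) (insert n' A)"
                using psi_Un[of "part u i n' a" "insert n' A" k] finA by simp
              also have "sum (wt k) (insert n' A) = int (card (insert n' A)) * ?P"
                using bigK by (intro sum_wt_eq) auto
              also have "card (insert n' A) = Suc (card A)" using finA by (simp add: A_def)
              finally show ?thesis using psiE[of k] wtg by (simp add: algebra_simps)
            qed
            have count: "(int c - int (card A) - 2) * ?P \<le> (int n' - int (tri (Suc k))) * ?P"
            proof -
              have "K \<subseteq> {tri (Suc k)..<n'} \<union> insert n' A" using E'g by (auto simp: K_def A_def)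
              then have "card K \<le> card ({tri (Suc k)..<n'} \<union> insert n' A)" using finA by (intro card_mono) auto
              also have "\<dots> \<le> card {tri (Suc k)..<n'} + card (insert n' A)" by (rule card_Un_le)
              also have "card (insert n' A) = Suc (card A)" using finA by (simp add: A_def)
              finally have "c \<le> n' - tri (Suc k) + card A + 2" using cK by simp
              then show ?thesis using n'(2) by (intro mult_right_mono) auto
            qed
            \<comment> \<open>At time \<open>r\<close> each disk below \<open>n'\<close> is on
              \<open>z\<close> or in \<open>X\<close>, and \<open>A\<close> is contained in
              \<open>X\<close>. At a common level only the union of the two piles matters, and its
              weights below \<open>n'\<close> have a known sum.\<close>
            have split: "2 * ((1 - int k) * ?P - 1) + (int k - 1) * ?P + 1 + (int n' - int (tri k)) * ?P
                + int (card A) * ?P \<le> psi k (part u r n' z) + psi k X"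
            proof -
              have "{..<n'} \<union> A \<subseteq> part u r n' z \<union> X"
                using at_r AX less_trans[OF _ n'(3)] by (auto simp: part_def X_def)
              then have "sum (wt k) ({..<n'} \<union> A) \<le> sum (wt k) (part u r n' z \<union> X)"
                using finX by (intro sum_wt_mono) auto
              also have "\<dots> \<le> sum (wt k) (part u r n' z) + sum (wt k) X"
                using sum_wt_nonneg[of k "part u r n' z \<inter> X"]
                  sum.union_inter[OF finite_part finX, of "wt k" u r n' z] by linarith
              also have "sum (wt k) ({..<n'} \<union> A) = sum (wt k) {..<n'} + sum (wt k) A"
                using finA by (intro sum.union_disjoint) (auto simp: A_def)
              also have "sum (wt k) A = int (card A) * ?P" using bigK by (intro sum_wt_eq) auto
              also have "sum (wt k) {..<n'} = (int k - 1) * ?P + 1 + (int n' - int (tri k)) * ?P"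
                using bigK[of n'] by (intro sum_wt_lessThan) auto
              finally show ?thesis by (simp add: psi_def algebra_simps)
            qed
            \<comment> \<open>With the secant line the tower of \<open>A2\<close> counts linearly,
              and by \<open>card B + card A2 = card A\<close> the unknown split at \<open>e1\<close>
              drops out. What remains is \<open>count\<close>, since
              \<open>tri (Suc k) = tri k + k + 1\<close>.\<close>
            have "(1 - int k) * ?P + int (card A2) * ?P \<le> 2 ^ card A2" by (rule two_power_line)
            then show ?thesis
              using total psi_n' psi_c count split cards by (simp add: algebra_simps)
          qed
        qed
      qed
    qed
  qed
qed

declare tri.simps(2) [simp del]

lemma fill_lower:
  assumes "walk u" "i \<le> j" "a \<noteq> b" "a < 4" "b < 4" "avoids u i n a" "avoids u i n b"
  shows "psi l (part u j n a) \<le> int (mv u {..<n} i j)"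
proof -
  have "psi l (part (rev_walk j u) 0 n a) \<le> int (mv (rev_walk j u) {..<n} 0 (j - i))"
    using assms walk_rev[OF assms(1), of j, unfolded rev_walk_def]
    by (intro clear_lower[of "rev_walk j u" 0 "j - i" a b]) (auto simp: avoids_def rev_walk_def)
  moreover have "part (rev_walk j u) 0 n a = part u j n a" by (simp add: part_def rev_walk_apply)
  ultimately show ?thesis using mv_rev[of i j j u "{..<n}"] assms by simp
qed

text \<open>The two pegs of a move are free of smaller disks, which is the final condition of
  \<open>clear_lower\<close> for either peg.\<close>

lemma clear_before_move:
  assumes w: "walk u" and m: "moved u t D" and n: "n \<le> D" and i: "i \<le> t" and a: "a = u t D \<or> a = u (Suc t) D"
  shows "psi l (part u i n a) \<le> int (mv u {..<n} i t)"
  using move_avoids(1,2)[OF w m] a n m walk_peg[OF w]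
  by (intro clear_lower[OF w i, of a "if a = u t D then u (Suc t) D else u t D"])
    (auto simp: moved_def intro: avoids_le)

lemma fill_after_move:
  assumes w: "walk u" and m: "moved u t D" and n: "n \<le> D" and j: "Suc t \<le> j" and a: "a = u t D \<or> a = u (Suc t) D"
  shows "psi l (part u j n a) \<le> int (mv u {..<n} (Suc t) j)"
  using move_avoids(3,4)[OF w m] a n m walk_peg[OF w]
  by (intro fill_lower[OF w j, of a "if a = u t D then u (Suc t) D else u t D"])
    (auto simp: moved_def intro: avoids_le)

text \<open>The surplus over \<open>psi k\<close> is what raises the level from \<open>k\<close> to \<open>Suc k\<close> in \<open>hop_lower\<close>.\<close>

lemma transfer_lower:
  assumes w: "walk u" and t12: "t1 \<le> t2" and pegs: "p < 4" "v < 4" "z < 4" "p \<noteq> v" "z \<noteq> p" "z \<noteq> v"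
    and start: "\<And>D. D < n \<Longrightarrow> u t1 D = p \<or> u t1 D = v"
  shows "psi k (part u t2 n z) + int (card {e \<in> part u t2 n z. tri (Suc k) \<le> e}) * 2 ^ k
      - sum (wt k) (part u t1 n v) \<le> int (mv u {..<n} t1 t2)"
proof -
  let ?P = "2 ^ k :: int"
  define B where "B = part u t2 n z"
  define V where "V = part u t1 n v"
  define BB where "BB = {e \<in> B. tri (Suc k) \<le> e}"
  \<comment> \<open>Heavy disks of \<open>B\<close> coming from \<open>v\<close> are compensated by
    the subtracted weights of \<open>V\<close>; those from \<open>p\<close> need an argument. Above
    their maximum \<open>m\<close>, all disks of \<open>B\<close> come from
    \<open>v\<close>.\<close>
  define C where "C = {e \<in> BB. u t1 e = p}"
  have fin: "finite B" "finite V" "finite BB" "finite C" by (simp_all add: B_def V_def BB_def C_def)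
  have big: "tri k \<le> e" if "tri (Suc k) \<le> e" for e using that tri_mono[of k "Suc k"] by simp
  have "psi k B + int (card BB) * ?P - sum (wt k) V \<le> int (mv u {..<n} t1 t2)"
  proof (cases "C = {}")
    case True
    obtain x where x: "x < 4" "x \<noteq> p" "x \<noteq> v" "x \<noteq> z" by (rule other_peg[of p v z]) (use pegs in auto)
    have "psi k B \<le> int (mv u {..<n} t1 t2)"
      unfolding B_def using x pegs start by (intro fill_lower[OF w t12, of z x]) (auto simp: avoids_def)
    moreover have "BB \<subseteq> V" using True start by (auto simp: C_def BB_def B_def V_def part_def)
    then have "sum (wt k) BB \<le> sum (wt k) V" using fin by (intro sum_wt_mono)
    moreover have "sum (wt k) BB = int (card BB) * ?P"
      using big by (intro sum_wt_eq) (auto simp: BB_def)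
    ultimately show ?thesis by linarith
  next
    case False
    define m where "m = Max C"
    have mC: "m \<in> C" using False fin unfolding m_def by (intro Max_in)
    have Cle: "e \<le> m" if "e \<in> C" for e using that fin by (simp add: m_def)
    have m: "m < n" "u t2 m = z" "tri (Suc k) \<le> m" "u t1 m = p"
      using mC by (auto simp: C_def BB_def B_def part_def)
    define S where "S = {e \<in> B. m < e}"
    have S: "u t1 e = v" "u t2 e = z" "m < e" "e < n" "tri (Suc k) \<le> e" if "e \<in> S" for e
    proof -
      show "u t2 e = z" "m < e" "e < n" using that by (auto simp: S_def B_def part_def)
      show "tri (Suc k) \<le> e" using m(3) \<open>m < e\<close> by simp
      then have "e \<notin> C \<Longrightarrow> u t1 e \<noteq> p" using that by (auto simp: C_def BB_def S_def)
      moreover have "e \<notin> C" using Cle[of e] \<open>m < e\<close> by auto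
      ultimately show "u t1 e = v" using start[OF \<open>e < n\<close>] by auto
    qed
    have finS: "finite S" using fin by (simp add: S_def)
    have psiB: "psi k B = psi k (part u t2 m z) + ?P + int (card S) * ?P"
    proof -
      have "B = part u t2 m z \<union> insert m S" using m by (auto simp: B_def S_def part_def)
      moreover have "part u t2 m z \<inter> insert m S = {}" by (auto simp: S_def part_def)
      ultimately have "psi k B = psi k (part u t2 m z) + sum (wt k) (insert m S)"
        using psi_Un[of "part u t2 m z" "insert m S" k] finS by simp
      also have "sum (wt k) (insert m S) = int (card (insert m S)) * ?P"
        using S(5) m(3) big by (intro sum_wt_eq) auto
      also have "card (insert m S) = Suc (card S)" using finS by (simp add: S_def)
      finally show ?thesis by (simp add: algebra_simps)
    qed
    have cardBB: "int (card BB) * ?P \<le> (int m - int (tri (Suc k)) + 1 + int (card S)) * ?P"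
    proof -
      have "BB \<subseteq> {tri (Suc k)..<m} \<union> insert m S" using m by (auto simp: BB_def S_def)
      then have "card BB \<le> card ({tri (Suc k)..<m} \<union> insert m S)" using finS by (intro card_mono) auto
      also have "\<dots> \<le> card {tri (Suc k)..<m} + card (insert m S)" by (rule card_Un_le)
      also have "card (insert m S) = Suc (card S)" using finS by (simp add: S_def)
      finally have "card BB \<le> m - tri (Suc k) + 1 + card S" by simp
      then show ?thesis using m(3) by (intro mult_right_mono) auto
    qed
    have sumV: "sum (wt k) (part u t1 m v) + int (card S) * ?P \<le> sum (wt k) V"
    proof -
      have "part u t1 m v \<union> S \<subseteq> V" using S(1,4) less_trans[OF _ m(1)] by (auto simp: V_def part_def)
      then have "sum (wt k) (part u t1 m v \<union> S) \<le> sum (wt k) V" using fin by (intro sum_wt_mono)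
      also have "sum (wt k) (part u t1 m v \<union> S) = sum (wt k) (part u t1 m v) + sum (wt k) S"
        using finS by (intro sum.union_disjoint) (auto simp: part_def S_def)
      also have "sum (wt k) S = int (card S) * ?P" using S(5) big by (intro sum_wt_eq) auto
      finally show ?thesis .
    qed
    have psiD: "psi k (part u t1 m p) =
        (1 - int k) * ?P - 1 + ((int k - 1) * ?P + 1 + (int m - int (tri (Suc k)) + int k + 1) * ?P) - sum (wt k) (part u t1 m v)"
    proof -
      have "{..<m} = part u t1 m p \<union> part u t1 m v" using start less_trans[OF _ m(1)] by (auto simp: part_def)
      moreover have "part u t1 m p \<inter> part u t1 m v = {}" using pegs by (auto simp: part_def)
      ultimately have "sum (wt k) {..<m} = sum (wt k) (part u t1 m p) + sum (wt k) (part u t1 m v)"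
        by (simp add: sum.union_disjoint)
      moreover have "sum (wt k) {..<m} = (int k - 1) * ?P + 1 + (int m - int (tri k)) * ?P"
        using m(3) big by (intro sum_wt_lessThan) auto
      ultimately show ?thesis by (simp add: psi_def tri.simps(2) algebra_simps)
    qed
    obtain r where r: "t1 \<le> r" "r < t2" "u r m = p" "u (Suc r) m \<noteq> p" and mr: "moved u r m"
        and still: "\<And>t. t1 \<le> t \<Longrightarrow> t \<le> r \<Longrightarrow> u t m = p"
      by (rule first_leave[of t1 t2 u m p]) (use t12 m pegs in auto)
    have before: "psi k (part u t1 m p) \<le> int (mv u {..<m} t1 r)"
      using r by (intro clear_before_move[OF w mr]) auto
    \<comment> \<open>Until \<open>r\<close> the disk \<open>m\<close> rests on \<open>p\<close>, so
      larger disks that go from \<open>v\<close> to \<open>z\<close> in this period make a three-peg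
      transfer.\<close>
    have tower: "2 ^ card S0 \<le> int (mv u S0 t1 r) + 1" if "S0 \<subseteq> S" "\<And>e. e \<in> S0 \<Longrightarrow> u r e = z" for S0
    proof -
      have "2 ^ card S0 \<le> mv u S0 t1 r + 1"
        using that S finite_subset[OF that(1) finS] pegs still
        by (intro stack_moves[OF w _ r(1), of S0 m p v z]) auto
      from iffD2[OF of_nat_le_iff[where 'a = int] this] show ?thesis by simp
    qed
    have early: "int (mv u {..<m} t1 r) + int (mv u S0 t1 r) \<le> int (mv u {..<n} t1 r)" if "S0 \<subseteq> S" for S0
    proof -
      have "mv u {..<m} t1 r + mv u S0 t1 r \<le> mv u {..<n} t1 r"
        using that S(3,4) m(1) by (intro mv_Un_le[OF w]) force+
      then show ?thesis by simp
    qed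
    \<comment> \<open>\<open>H\<close> contains the disks above \<open>m\<close> not yet on
      \<open>z\<close> when \<open>m\<close> first leaves \<open>p\<close>. Its maximum
      \<open>h\<close> lands on \<open>z\<close> only when no smaller disk is there, so the final
      pile below \<open>h\<close>, including \<open>m\<close>, is built afterwards; the disks above
      \<open>h\<close> are paid by \<open>tower\<close>.\<close>
    define H where "H = {e \<in> S. u r e \<noteq> z}"
    show ?thesis
    proof (cases "H = {}")
      case True
      obtain s where s: "r \<le> s" "s < t2" "u s m \<noteq> z" "u (Suc s) m = z" and ms: "moved u s m"
        by (rule last_enter[of r t2 u m z]) (use r m pegs in auto)
      have "psi k (part u t2 m z) \<le> int (mv u {..<m} (Suc s) t2)"
        using s by (intro fill_after_move[OF w ms]) auto
      moreover have "1 \<le> mv u {m} s (Suc s)" by (rule mv_pos[OF ms]) auto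
      moreover have "mv u {..<n} t1 t2 = mv u {..<n} t1 r + mv u {..<n} r s + mv u {..<n} s (Suc s) + mv u {..<n} (Suc s) t2"
        using r s mv_split[of t1 r t2 u "{..<n}"] mv_split[of r s t2 u "{..<n}"] mv_split[of s "Suc s" t2 u "{..<n}"] by simp
      moreover have "mv u {m} s (Suc s) \<le> mv u {..<n} s (Suc s)" using m by (intro mv_mono) auto
      moreover have "mv u {..<m} (Suc s) t2 \<le> mv u {..<n} (Suc s) t2" using m by (intro mv_mono) auto
      moreover have "2 ^ card S \<le> int (mv u S t1 r) + 1" using True by (intro tower) (auto simp: H_def)
      moreover have "(1 - int k) * ?P + int (card S) * ?P \<le> 2 ^ card S" by (rule two_power_line)
      ultimately show ?thesis
        using before early[OF order_refl] psiB cardBB sumV psiD by (simp add: algebra_simps)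
    next
      case False
      define h where "h = Max H"
      have finH: "finite H" using finS by (simp add: H_def)
      then have hH: "h \<in> H" using False unfolding h_def by (intro Max_in)
      have Hle: "e \<le> h" if "e \<in> H" for e using that finH by (simp add: h_def)
      have h: "h \<in> S" "u r h \<noteq> z" using hH by (auto simp: H_def)
      define S1 where "S1 = {e \<in> S. h < e}"
      define S2 where "S2 = {e \<in> S. e < h}"
      have S12: "finite S1" "finite S2" "S1 \<subseteq> S" "S = insert h (S1 \<union> S2)"
        using finS h by (auto simp: S1_def S2_def)
      have "card S = Suc (card (S1 \<union> S2))"
        unfolding S12(4) using S12(1,2) by (intro card_insert_disjoint) (auto simp: S1_def S2_def)
      also have "card (S1 \<union> S2) = card S1 + card S2"
        using S12(1,2) by (intro card_Un_disjoint) (auto simp: S1_def S2_def)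
      finally have cards: "card S = Suc (card S1 + card S2)" .
      obtain s where s: "r \<le> s" "s < t2" "u s h \<noteq> z" "u (Suc s) h = z" and ms: "moved u s h"
        by (rule last_enter[of r t2 u h z]) (use r h S(2) in auto)
      have "psi k (part u t2 h z) \<le> int (mv u {..<h} (Suc s) t2)"
        using s by (intro fill_after_move[OF w ms]) auto
      moreover have "psi k (part u t2 m z) + ?P + int (card S2) * ?P \<le> psi k (part u t2 h z)"
      proof -
        have "part u t2 m z \<union> insert m S2 \<subseteq> part u t2 h z"
          using S(2,3)[OF h(1)] S(2) m by (auto simp: part_def S2_def)
        then have "psi k (part u t2 m z \<union> insert m S2) \<le> psi k (part u t2 h z)" by (intro psi_mono) auto
        also have "psi k (part u t2 m z \<union> insert m S2) = psi k (part u t2 m z) + sum (wt k) (insert m S2)"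
          using S12(2) by (intro psi_Un) (auto simp: part_def S2_def S_def)
        also have "sum (wt k) (insert m S2) = int (card (insert m S2)) * ?P"
          using S(5) m(3) big by (intro sum_wt_eq) (auto simp: S2_def)
        also have "card (insert m S2) = Suc (card S2)"
          using S12(2) by (intro card_insert_disjoint) (auto simp: S2_def S_def)
        finally show ?thesis by (simp add: algebra_simps)
      qed
      moreover have "1 \<le> mv u {h} s (Suc s)" by (rule mv_pos[OF ms]) auto
      moreover have "mv u {..<n} t1 t2 = mv u {..<n} t1 r + mv u {..<n} r s + mv u {..<n} s (Suc s) + mv u {..<n} (Suc s) t2"
        using r s mv_split[of t1 r t2 u "{..<n}"] mv_split[of r s t2 u "{..<n}"] mv_split[of s "Suc s" t2 u "{..<n}"] by simp
      moreover have "mv u {h} s (Suc s) \<le> mv u {..<n} s (Suc s)" using S(4)[OF h(1)] by (intro mv_mono) auto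
      moreover have "mv u {..<h} (Suc s) t2 \<le> mv u {..<n} (Suc s) t2" using S(4)[OF h(1)] by (intro mv_mono) auto
      moreover have "2 ^ card S1 \<le> int (mv u S1 t1 r) + 1"
      proof (rule tower[OF S12(3)])
        fix e assume e: "e \<in> S1"
        then have "e \<notin> H" using Hle[of e] by (auto simp: S1_def)
        then show "u r e = z" using e by (auto simp: S1_def H_def)
      qed
      moreover have "(1 - int k) * ?P + int (card S1) * ?P \<le> 2 ^ card S1" by (rule two_power_line)
      ultimately show ?thesis
        using before early[OF S12(3)] psiB cardBB sumV psiD cards by (simp add: algebra_simps)
    qed
  qed
  then show ?thesis by (simp only: B_def V_def BB_def)
qed

section \<open>Two stacks\<close>

lemma fill_from_two:
  assumes w: "walk u" "i \<le> t" and pegs: "c < 4" "d < 4" "f < 4" "f \<noteq> c" "f \<noteq> d"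
    and start: "\<And>D. D < n \<Longrightarrow> u i D = c \<or> u i D = d"
  shows "psi l (part u t n f) \<le> int (mv u {..<n} i t)"
proof -
  obtain y where "y < 4" "y \<noteq> c" "y \<noteq> d" "y \<noteq> f" by (rule other_peg[of c d f]) (use pegs in auto)
  then show ?thesis using pegs start by (intro fill_lower[OF w, of f y]) (auto simp: avoids_def)
qed

text \<open>This is the case where the two largest disks \<open>b\<close> and \<open>m\<close> of the two stacks leave on the same
  side of the central move, \<open>b\<close> before \<open>m\<close>: the pegs \<open>c\<close> and \<open>x\<close> cleared at time \<open>j\<close> are those of
  the move of \<open>m\<close>.\<close>

lemma hop_lower:
  assumes "walk u" "i \<le> j" "c < 4" "d < 4" "x < 4" "c \<noteq> d" "x \<noteq> c"
    and "\<And>D. D < m \<Longrightarrow> u i D = c \<or> u i D = d"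
    and "b < m" "u i b = d" "\<And>D. D < m \<Longrightarrow> b < D \<Longrightarrow> u i D = c"
    and "\<exists>t. i \<le> t \<and> t < j \<and> moved u t b"
    and "avoids u j m c" "avoids u j m x"
  shows "(1 - 2 * int l) * 2 ^ l - 1 + sum (wt l) {..<m} \<le> int (mv u {..<m} i j)"
  using assms
proof (induction m arbitrary: u i j c d x b l rule: less_induct)
  case (less m)
  note w = less.prems(1)
  note ij = less.prems(2)
  note pegs = less.prems(3-7)
  note start = less.prems(8)
  note b = less.prems(9,10)
  note above = less.prems(11)
  note avc = less.prems(13) and avx = less.prems(14)
  obtain t0 where t0: "i \<le> t0" "t0 < j" and mt0: "moved u t0 b" using less.prems(12) by blast
  obtain g where m: "m = Suc g" using b(1) by (cases m) auto
  have mUn: "mv u {..<m} i' j' = mv u {..<g} i' j' + mv u {g} i' j'" for i' j'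
  proof -
    have "{..<m} = {..<g} \<union> {g}" by (auto simp: m)
    then show ?thesis using mv_Un[OF w, of "{..<g}" "{g}"] by simp
  qed
  have sum_m: "sum (wt l) {..<m} = sum (wt l) {..<g} + wt l g" for l by (simp add: m)
  have endcx: "u j D \<noteq> c" "u j D \<noteq> x" if "D < m" for D using avc avx that by (auto simp: avoids_def)
  have clear: "psi l (part u t n h) \<le> int (mv u {..<n} t j)" if "t \<le> j" "h = c \<or> h = x" "n \<le> m" for l t n h
    using that pegs avoids_le[OF avc that(3)] avoids_le[OF avx that(3)]
    by (intro clear_lower[OF w that(1), of h "if h = c then x else c"]) auto
  show ?case
  proof (cases "b = g")
    case bg: True
    \<comment> \<open>The constant arises here: two piles give
      \<open>2 * ((1 - l) * 2 ^ l - 1)\<close>, and \<open>g\<close> contributes one move in place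
      of a weight of at most \<open>2 ^ l\<close>. Peg \<open>f\<close> is free of the disks below
      \<open>m\<close> at \<open>i\<close>, so its pile was built before \<open>t\<close>; peg
      \<open>h\<close> is free of them at \<open>j\<close>, so its pile is cleared after
      \<open>t\<close>.\<close>
    have two_sided: ?thesis
      if t: "i \<le> t" "t < j" and mt: "moved u t g" and fh: "f < 4" "f \<noteq> c" "f \<noteq> d" "h = c \<or> h = x"
        and at: "\<And>D. D < g \<Longrightarrow> u t D = f \<or> u t D = h" and "f \<noteq> h" for t f h
    proof -
      have "psi l (part u t g f) \<le> int (mv u {..<g} i t)"
        using t fh pegs start by (intro fill_from_two[OF w, of i t c d]) (auto simp: m)
      moreover have "psi l (part u t g h) \<le> int (mv u {..<g} (Suc t) j)"
        using clear[of "Suc t" h g l] t fh part_move[OF w mt order_refl] by (simp add: m)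
      moreover have "mv u {..<g} i t + mv u {..<g} (Suc t) j \<le> mv u {..<g} i j"
        using t by (intro mv_chain) auto
      moreover have "1 \<le> mv u {g} i j" by (rule mv_pos[OF mt]) (use t in auto)
      moreover have "{..<g} = part u t g f \<union> part u t g h" "part u t g f \<inter> part u t g h = {}"
        using at \<open>f \<noteq> h\<close> by (auto simp: part_def)
      then have "sum (wt l) {..<g} = sum (wt l) (part u t g f) + sum (wt l) (part u t g h)"
        by (simp add: sum.union_disjoint)
      ultimately show ?thesis using mUn[of i j] sum_m[of l] wt_le[of l g]
        by (simp add: psi_def algebra_simps)
    qed
    show ?thesis
    proof (cases "x = d")
      case True
      have "u j g \<notin> {c, d}" using endcx[of g] True by (auto simp: m)
      then obtain r where r: "i \<le> r" "r < j" "u r g \<in> {c, d}" "u (Suc r) g \<notin> {c, d}" and mr: "moved u r g"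
        using last_exit[of i j u g "{c, d}"] b bg ij by blast
      obtain z where z: "z < 4" "z \<noteq> c" "z \<noteq> d" "z \<noteq> u (Suc r) g"
        by (rule other_peg[of c d "u (Suc r) g"]) (use pegs walk_peg[OF w] in auto)
      have at: "u r D = c \<or> u r D = d \<or> u r D = u (Suc r) g \<or> u r D = z" for D
        using z r pegs walk_peg[OF w] by (intro four_pegs) auto
      show ?thesis
        using walk_avoid(1,2)[OF w mr] at r z True
        by (intro two_sided[OF r(1,2) mr z(1-3), of "if u r g = c then d else c"]) auto
    next
      case False
      obtain t where t: "i \<le> t" "t < j" "u t g = d" "u (Suc t) g \<noteq> d" and mt: "moved u t g"
      proof -
        define t1 where "t1 = (if u t0 g = d then Suc t0 else t0)"
        have "i \<le> t1" "t1 \<le> j" "u t1 g \<noteq> d" using t0 mt0 bg by (auto simp: t1_def moved_def)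
        then show ?thesis using first_leave[of i t1 u g d] b bg that by (metis less_le_trans)
      qed
      obtain e where e: "e < 4" "e \<noteq> c" "e \<noteq> d" "e \<noteq> x"
        by (rule other_peg[of c d x]) (use pegs in auto)
      have at: "u t' D = c \<or> u t' D = d \<or> u t' D = e \<or> u t' D = x" for t' D
        using e pegs False walk_peg[OF w] by (intro four_pegs) auto
      have away: "u t D \<noteq> d" "u t D \<noteq> u (Suc t) g" if "D < g" for D
        using walk_avoid(1,2)[OF w mt that] t by auto
      consider "u (Suc t) g = c" | "u (Suc t) g = e" | "u (Suc t) g = x" using at[of "Suc t" g] t by auto
      then show ?thesis
      proof cases
        case 1 then show ?thesis using away at e
          by (intro two_sided[OF t(1,2) mt e(1-3), of x]) metis+
      next
        case 2 then show ?thesis using away at False pegs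
          by (intro two_sided[OF t(1,2) mt, of x c]) metis+
      next
        case 3 then show ?thesis using away at e
          by (intro two_sided[OF t(1,2) mt e(1-3), of c]) metis+
      qed
    qed
  next
    case False
    then have bg: "b < g" using b m by simp
    have gc: "u i g = c" using above bg m by simp
    have "u j g \<notin> {c, x}" using endcx[of g] by (auto simp: m)
    then obtain r where r: "i \<le> r" "r < j" "u r g \<in> {c, x}" "u (Suc r) g \<notin> {c, x}" and mr: "moved u r g"
      using last_exit[of i j u g "{c, x}"] gc ij by blast
    define s where "s = u r g"
    define s' where "s' = (if s = c then x else c)"
    define e where "e = u (Suc r) g"
    have sx: "s = c \<and> s' = x \<or> s = x \<and> s' = c" using r by (auto simp: s_def s'_def)
    have ecx: "e < 4" "e \<noteq> c" "e \<noteq> x" using r walk_peg[OF w] by (auto simp: e_def)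
    obtain z where z: "z < 4" "z \<noteq> c" "z \<noteq> x" "z \<noteq> e"
      by (rule other_peg[of c x e]) (use pegs ecx in auto)
    have pegs4: "y = s \<or> y = s' \<or> y = e \<or> y = z" if "y < 4" for y
      using four_pegs[of c x e z y] that z ecx pegs sx by auto
    have dist: "distinct [s, s', e, z]" "s < 4" "s' < 4" using sx z ecx pegs by auto
    have at_r: "u r D = s' \<or> u r D = z" if "D < g" for D
      using pegs4[of "u r D"] walk_avoid(1,2)[OF w mr that] walk_peg[OF w] by (auto simp: s_def e_def)
    define X where "X = part u r g s'"
    have finX: "finite X" by (simp add: X_def)
    have after: "psi l X \<le> int (mv u {..<g} (Suc r) j)" for l
      using clear[of "Suc r" s' g l] r sx part_move[OF w mr order_refl] by (auto simp: m X_def)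
    have g1: "1 \<le> mv u {g} i j" by (rule mv_pos[OF mr]) (use r in auto)
    have total: "int (mv u {..<g} i r) + 1 + int (mv u {..<g} (Suc r) j) \<le> int (mv u {..<m} i j)"
      using mUn[of i j] g1 mv_chain[of i r "Suc r" j u "{..<g}"] r by simp
    \<comment> \<open>At level 0 the claim is that every disk below \<open>m\<close> moves: those on
      \<open>c\<close> because \<open>c\<close> is cleared, those on \<open>d\<close> because they
      are \<open>b\<close> or lie on top of it.\<close>
    have zero: "(1 - 2 * int 0) * 2 ^ 0 - 1 + sum (wt 0) {..<m} \<le> int (mv u {..<m} i j)"
    proof -
      have mover: "\<exists>t. i \<le> t \<and> t < j \<and> moved u t D" if D: "D < m" for D
      proof (cases "u i D = c")
        case True
        then show ?thesis using first_leave[of i j u D c] endcx(1)[OF D] ij by metis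
      next
        case False
        then have Dd: "u i D = d" using start[OF D] by auto
        then have "D \<le> b" using above[OF D] pegs by force
        show ?thesis
        proof (cases "D = b")
          case True then show ?thesis using t0 mt0 by auto
        next
          case False
          then have Db: "D < b" using \<open>D \<le> b\<close> by simp
          define t1 where "t1 = (if u t0 b = d then Suc t0 else t0)"
          have t1: "i \<le> t1" "t1 \<le> j" "u t1 b \<noteq> d" using t0 mt0 by (auto simp: t1_def moved_def)
          obtain t where t: "i \<le> t" "t < t1" "u t b = d" and mt: "moved u t b"
            by (rule first_leave[of i t1 u b d]) (use t1 b in auto)
          have "u t D \<noteq> d" using walk_avoid(1)[OF w mt Db] t by simp
          then obtain t2 where "i \<le> t2" "t2 < t" "moved u t2 D"
            using first_leave[of i t u D d] t Dd by metis
          then show ?thesis using t t1 by (intro exI[of _ t2]) auto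
        qed
      qed
      then have "card {..<m} \<le> mv u {..<m} i j" by (intro mv_each[OF w]) auto
      then show ?thesis by simp
    qed
    show ?thesis
    proof (cases "part u r g z = {}")
      case True
      then have "X = {..<g}" using at_r by (auto simp: X_def part_def)
      then have "1 + psi l {..<g} \<le> int (mv u {..<m} i j)" using after[of l] total by simp
      moreover have "(1 - 2 * int l) * 2 ^ l + wt l g \<le> 1 + (1 - int l) * 2 ^ l"
      proof (cases l)
        case (Suc k)
        have "1 * 2 ^ l \<le> int l * 2 ^ l" by (rule mult_right_mono) (use Suc in auto)
        then have "wt l g \<le> int l * 2 ^ l" using wt_le[of l g] by linarith
        then show ?thesis by (simp add: algebra_simps)
      qed simp
      ultimately show ?thesis using sum_m[of l] by (simp add: psi_def)
    next
      case False
      define n' where "n' = Max (part u r g z)"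
      have "n' \<in> part u r g z" using False unfolding n'_def by (intro Max_in) auto
      then have n': "n' < g" "u r n' = z" by (auto simp: part_def)
      have n'max: "D \<le> n'" if "D < g" "u r D = z" for D
        using that unfolding n'_def by (intro Max_ge) (auto simp: part_def)
      show ?thesis
      proof (cases "\<exists>t. i \<le> t \<and> t \<le> r \<and> u t n' \<noteq> z")
        case True
        then obtain ta where ta: "i \<le> ta" "ta \<le> r" "u ta n' \<noteq> z" by blast
        obtain b' where b': "ta \<le> b'" "b' < r" "u b' n' \<noteq> z" "u (Suc b') n' = z" and mb: "moved u b' n'"
          by (rule last_enter[of ta r u n' z]) (use ta n' in auto)
        define y where "y = u b' n'"
        have y: "y < 4" "y \<noteq> z" using b' walk_peg[OF w] by (auto simp: y_def)
        obtain q1 where q1: "q1 < 4" "q1 \<noteq> z" "q1 \<noteq> y" by (rule other_peg[of z y y]) (use z y in auto)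
        obtain q2 where q2: "q2 < 4" "q2 \<noteq> z" "q2 \<noteq> y" "q2 \<noteq> q1"
          by (rule other_peg[of z y q1]) (use z y q1 in auto)
        have at_b: "u b' D = q1 \<or> u b' D = q2" if "D < n'" for D
          using four_pegs[of z y q1 q2 "u b' D"] z y q1 q2 walk_peg[OF w] walk_avoid(1,2)[OF w mb that] b'
          by (auto simp: y_def)
        \<comment> \<open>\<open>p\<close> and \<open>v\<close> hold the disks below
          \<open>n'\<close> when it lands on \<open>z\<close>. Excluding \<open>o'\<close> for
          \<open>v\<close> guarantees that the pile on \<open>v\<close> was built after
          \<open>i\<close>: \<open>v\<close> is either a fresh peg or the starting peg of
          \<open>n'\<close>, which had to be emptied when \<open>n'\<close> left it.\<close>
        define o' where "o' = (if u i n' = c then d else c)"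
        define v where "v = (if q1 = o' then q2 else q1)"
        define p where "p = (if q1 = o' then q1 else q2)"
        have vp: "v < 4" "p < 4" "v \<noteq> z" "p \<noteq> z" "p \<noteq> v" "v \<noteq> o'" "v \<noteq> y"
          using q1 q2 by (auto simp: v_def p_def)
        have at_b': "u b' D = p \<or> u b' D = v" if "D < n'" for D
          using at_b[OF that] by (auto simp: v_def p_def)
        have ib: "i \<le> b'" using ta b' by simp
        have oc: "u i n' = c \<and> o' = d \<or> u i n' = d \<and> o' = c"
          using start[of n'] n' m pegs by (auto simp: o'_def)
        have pre: "psi k (part u b' n' v) \<le> int (mv u {..<n'} i b')" for k
        proof (cases "v = u i n'")
          case True
          then have "u b' n' \<noteq> u i n'" using vp y_def by simp
          then obtain a' where a': "i \<le> a'" "a' < b'" "u a' n' = u i n'" and ma: "moved u a' n'"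
            using first_leave[of i b' u n' "u i n'"] ib by metis
          have "psi k (part u b' n' v) \<le> int (mv u {..<n'} (Suc a') b')"
            using a' True by (intro fill_after_move[OF w ma]) auto
          moreover have "mv u {..<n'} (Suc a') b' \<le> mv u {..<n'} i b'" using a' by (intro mv_mono) auto
          ultimately show ?thesis by simp
        next
          case False
          then have "v \<noteq> c" "v \<noteq> d" using oc vp by auto
          then show ?thesis using ib vp pegs start n' m
            by (intro fill_from_two[OF w, of i b' c d]) auto
        qed
        \<comment> \<open>For \<open>l = Suc k\<close> the piles on \<open>v\<close> and
          \<open>z\<close> are counted at level \<open>k\<close>. The weights on \<open>v\<close>
          cancel, the surplus of \<open>transfer_lower\<close> lifts those on \<open>z\<close> to
          level \<open>l\<close>, and two constants \<open>(1 - k) * 2 ^ k\<close> exceed one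
          constant of level \<open>l\<close> by \<open>2 ^ l\<close>.\<close>
        show ?thesis
        proof (cases l)
          case 0 then show ?thesis using zero by simp
        next
          case (Suc k)
          let ?P = "2 ^ k :: int"
          define B where "B = part u r n' z"
          define BB where "BB = {e \<in> B. tri (Suc k) \<le> e}"
          have tr: "psi k B + int (card BB) * ?P - sum (wt k) (part u b' n' v) \<le> int (mv u {..<n'} b' r)"
            unfolding B_def BB_def using b' vp z at_b' by (intro transfer_lower[OF w, of b' r p v z]) auto
          have "1 \<le> mv u {n'} i r" by (rule mv_pos[OF mb]) (use ib b' in auto)
          moreover have "mv u {..<n'} i r + mv u {n'} i r \<le> mv u {..<g} i r"
            using n' by (intro mv_Un_le[OF w]) auto
          ultimately have "psi k (part u b' n' v) + (psi k B + int (card BB) * ?P - sum (wt k) (part u b' n' v))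
              + 1 + 1 + psi l X \<le> int (mv u {..<m} i j)"
            using pre[of k] tr after[of l] total mv_split[of i b' r u "{..<n'}"] ib b' by simp
          moreover have "sum (wt l) B = sum (wt k) B + int (card BB) * ?P"
            using sum_wt_Suc[of B k] by (simp add: B_def BB_def Suc del: wt.simps)
          moreover have "sum (wt l) {..<g} = sum (wt l) X + (sum (wt l) B + wt l n')"
          proof -
            have "{..<g} = X \<union> insert n' B"
              using at_r n' n'max by (force simp: X_def B_def part_def)
            moreover have "X \<inter> insert n' B = {}" using n' dist by (auto simp: X_def B_def part_def)
            moreover have "sum (wt l) (insert n' B) = sum (wt l) B + wt l n'"
              by (subst sum.insert) (auto simp: B_def part_def)
            moreover have "finite (insert n' B)" by (simp add: B_def)
            ultimately show ?thesis using finX by (metis sum.union_disjoint)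
          qed
          ultimately show ?thesis
            using sum_m[of l] wt_le[of l g] wt_le[of l n'] by (simp add: psi_def Suc algebra_simps del: wt.simps)
        qed
      next
        case False
        then have still: "u t n' = z" if "i \<le> t" "t \<le> r" for t using that by blast
        \<comment> \<open>If \<open>n'\<close> has rested on \<open>z\<close> since
          \<open>i\<close>, then \<open>z = d\<close>, and \<open>n' = b\<close>: a smaller disk
          resting on \<open>d\<close> would have kept \<open>b\<close> there. So \<open>b\<close>
          leaves only after the last exit of \<open>g\<close>.\<close>
        have zd: "z = d" using still[of i] r start[of n'] n' m z by auto
        have "n' = b"
        proof (rule ccontr)
          assume ne: "n' \<noteq> b"
          have "n' \<le> b" using above[of n'] n' m still[of i] r z by force
          then have lt: "n' < b" using ne by simp
          have "u r b \<noteq> z" using n'max[of b] bg lt by auto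
          then obtain t where t: "i \<le> t" "t < r" "u t b = z" and mt: "moved u t b"
            using first_leave[of i r u b z] b zd r(1) by metis
          show False using walk_avoid(1)[OF w mt lt] still[of t] t by simp
        qed
        note still_b = still[unfolded this zd]
        note n'max = n'max[unfolded \<open>n' = b\<close> zd]
        note at_r = at_r[unfolded zd]
        have xd: "x \<noteq> d" "e \<noteq> d" using z zd by auto
        have t0r: "Suc r \<le> t0"
        proof (rule ccontr)
          assume "\<not> Suc r \<le> t0"
          then consider "t0 = r" | "t0 < r" by linarith
          then show False
          proof cases
            case 1 then show ?thesis using walk_unique[OF w mr, of b] mt0 bg by simp
          next
            case 2 then show ?thesis using still_b[of t0] still_b[of "Suc t0"] t0 mt0 by (simp add: moved_def)
          qed
        qed
        \<comment> \<open>\<open>X\<close> was newly built since \<open>i\<close>: either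
          \<open>s' = x\<close> is a fresh peg, or \<open>s' = c\<close> and \<open>g\<close> had to
          leave it first, which emptied it of smaller disks.\<close>
        have pre: "psi k X \<le> int (mv u {..<g} i r)" for k
        proof (cases "s' = x")
          case True
          then show ?thesis unfolding X_def using r pegs xd start m
            by (intro fill_from_two[OF w, of i r c d]) auto
        next
          case False
          then have "s' = c" "u r g \<noteq> c" using sx s_def pegs by auto
          then obtain a' where a': "i \<le> a'" "a' < r" "u a' g = c" and ma: "moved u a' g"
            using first_leave[of i r u g c] gc r(1) by metis
          have "psi k X \<le> int (mv u {..<g} (Suc a') r)"
            unfolding X_def using a' \<open>s' = c\<close> by (intro fill_after_move[OF w ma]) auto
          moreover have "mv u {..<g} (Suc a') r \<le> mv u {..<g} i r" using a' by (intro mv_mono) auto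
          ultimately show ?thesis by simp
        qed
        have same: "u (Suc r) D = u r D" if "D < g" for D using walk_avoid(3)[OF w mr that] .
        \<comment> \<open>After the exit of \<open>g\<close> the same situation recurs with one disk
          less, \<open>s'\<close> playing the role of \<open>c\<close> and \<open>s\<close> that of
          \<open>x\<close>.\<close>
        have rest: "(1 - 2 * int l) * 2 ^ l - 1 + sum (wt l) {..<g} \<le> int (mv u {..<g} (Suc r) j)" for l
        proof (rule less.IH[of g u "Suc r" j s' d s b])
          show "u (Suc r) D = s' \<or> u (Suc r) D = d" if "D < g" for D using at_r[OF that] same[OF that] by simp
          show "u (Suc r) D = s'" if "D < g" "b < D" for D
            using at_r[OF that(1)] same[OF that(1)] n'max[OF that(1)] that(2) by auto
          show "u (Suc r) b = d" using same[OF bg] still_b[of r] r by simp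
          show "\<exists>t. Suc r \<le> t \<and> t < j \<and> moved u t b" using t0 t0r mt0 by blast
          show "avoids u j g s'" "avoids u j g s" using avoids_le[OF avc, of g] avoids_le[OF avx, of g] sx m by auto
        qed (use w r m pegs dist zd bg in auto)
        show ?thesis
        proof (induction l)
          case 0 show ?case by (rule zero)
        next
          case (Suc k)
          let ?l = "Suc k"
          let ?P = "2 ^ k :: int"
          show ?case
          \<comment> \<open>From level \<open>k\<close> to \<open>?l\<close> the constant drops by
            \<open>(2 * k + 3) * 2 ^ k\<close>, so with at most
            \<open>2 * k + 3 = 2 * ?l + 1\<close> heavy disks the higher level gives nothing
            new.\<close>
          proof (cases "m < tri ?l + 2 * ?l + 2")
            case True
            have "{e \<in> {..<m}. tri ?l \<le> e} = {tri ?l..<m}" by auto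
            then have "sum (wt ?l) {..<m} = sum (wt k) {..<m} + int (m - tri ?l) * ?P"
              using sum_wt_Suc[of "{..<m}" k] by simp
            moreover have "int (m - tri ?l) * ?P \<le> (2 * int k + 3) * ?P"
              using True by (intro mult_right_mono) auto
            ultimately show ?thesis using Suc.IH by (simp add: algebra_simps del: wt.simps)
          next
            case m_big: False
            define cx where "cx = card {e \<in> X. tri ?l \<le> e}"
            show ?thesis
            proof (cases "?l \<le> cx")
              case True
              have "2 ^ ?l - 1 \<le> psi ?l X"
                using True finX by (intro psi_many[of X "{e \<in> X. tri ?l \<le> e}"]) (auto simp: cx_def)
              then show ?thesis using pre[of ?l] rest[of ?l] total sum_m[of ?l] wt_le[of ?l g] by linarith
            next
              case False
              then have cxk: "cx \<le> k" by simp
              obtain t where t: "r \<le> t" "t < Suc t0" "u t b = d" "u (Suc t) b \<noteq> d" and mt: "moved u t b"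
              proof -
                define t1 where "t1 = (if u t0 b = d then Suc t0 else t0)"
                have t1: "r \<le> t1" "t1 \<le> Suc t0" "u t1 b \<noteq> d" using t0r mt0 by (auto simp: t1_def moved_def)
                obtain t where "r \<le> t" "t < t1" "u t b = d" "u (Suc t) b \<noteq> d" "moved u t b"
                  by (rule first_leave[of r t1 u b d]) (use t1 still_b r in auto)
                then show ?thesis using t1 by (intro that[of t]) auto
              qed
              have "t \<noteq> r" using walk_unique[OF w mr, of b] mt bg by auto
              then have tr: "Suc r \<le> t" "Suc t \<le> j" using t t0 by auto
              define y where "y = u (Suc t) b"
              have y: "y = e \<or> y = s' \<or> y = s"
                using pegs4[of y] t zd walk_peg[OF w] by (auto simp: y_def)
              \<comment> \<open>When \<open>b\<close> leaves \<open>d\<close>, the smaller disks lie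
                on two pegs: \<open>v\<close>, one of \<open>c\<close> and \<open>x\<close> and
                hence still to be cleared, and \<open>f\<close>, which held no disk below
                \<open>g\<close> at time \<open>r\<close>.\<close>
              define v where "v = (if y = s' then s else s')"
              define f where "f = (if y = e then s else e)"
              have fv: "f < 4" "v = c \<or> v = x" "f \<noteq> s'" "f \<noteq> d" "f \<noteq> v" "v \<noteq> y" "v \<noteq> d"
                using y dist sx zd ecx by (auto simp: f_def v_def)
              have same_t: "u (Suc t) D = u t D" if "D \<noteq> b" for D
                using walk_unique[OF w mt, of D] that by (auto simp: moved_def)
              have at_t: "u t D = v \<or> u t D = f" if "D < b" for D
                using pegs4[of "u t D"] walk_peg[OF w] walk_avoid(1,2)[OF w mt that] t(3) y zd
                by (auto simp: v_def f_def y_def)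
              define W where "W = part u (Suc t) g v"
              have finW: "finite W" by (simp add: W_def)
              have post: "psi l W \<le> int (mv u {..<g} (Suc t) j)" for l
                unfolding W_def using tr fv m by (intro clear) auto
              have b1: "1 \<le> mv u {b} t (Suc t)" by (rule mv_pos[OF mt]) auto
              have "mv u {..<g} (Suc r) j =
                  mv u {..<g} (Suc r) t + mv u {..<g} t (Suc t) + mv u {..<g} (Suc t) j"
                using tr mv_split[of "Suc r" t j u "{..<g}"] mv_split[of t "Suc t" j u "{..<g}"] by simp
              moreover have "mv u {b} t (Suc t) \<le> mv u {..<g} t (Suc t)" using bg by (intro mv_mono) auto
              moreover have "mv u {..<b} (Suc r) t \<le> mv u {..<g} (Suc r) t" using bg by (intro mv_mono) auto
              ultimately have total': "psi k X + 1 + int (mv u {..<b} (Suc r) t) + 1 + psi k W \<le> int (mv u {..<m} i j)"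
                using total pre[of k] post[of k] b1 by linarith
              show ?thesis
              proof (cases "k \<le> card {e \<in> W. tri k \<le> e}")
                case True
                have "?P - 1 \<le> psi k W"
                  using True finW by (intro psi_many[of W "{e \<in> W. tri k \<le> e}"]) auto
                moreover have "psi ?l (part u r b d) \<le> int (mv u {..<b} (Suc r) t)"
                proof -
                  have "part u r b d = part u (Suc r) b d"
                    using part_move[OF w mr, of b d] bg by simp
                  then show ?thesis using clear_before_move[OF w mt order_refl tr(1), of d ?l] t by simp
                qed
                moreover have "sum (wt ?l) {..<g} = sum (wt ?l) X + (sum (wt ?l) (part u r b d) + wt ?l b)"
                proof -
                  have "{..<g} = X \<union> insert b (part u r b d)"
                  proof (intro equalityI subsetI)
                    fix D assume "D \<in> {..<g}"
                    then show "D \<in> X \<union> insert b (part u r b d)"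
                      using at_r[of D] n'max[of D] by (auto simp: X_def part_def)
                  qed (use bg in \<open>auto simp: X_def part_def\<close>)
                  moreover have "X \<inter> insert b (part u r b d) = {}"
                    using dist zd still_b[of r] r by (auto simp: X_def part_def)
                  moreover have "sum (wt ?l) (insert b (part u r b d)) = sum (wt ?l) (part u r b d) + wt ?l b"
                    by (subst sum.insert) (auto simp: part_def)
                  moreover have "finite (insert b (part u r b d))" by simp
                  ultimately show ?thesis using finX by (metis sum.union_disjoint)
                qed
                moreover have "sum (wt ?l) X = sum (wt k) X + int cx * ?P"
                  using sum_wt_Suc[OF finX, of k] by (simp only: cx_def)
                moreover have "int cx * ?P \<le> int k * ?P" using cxk by (intro mult_right_mono) auto
                moreover have "(1 - 2 * int ?l) * 2 ^ ?l = - 2 * ?P - 4 * (int k * ?P)"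
                  by (simp add: algebra_simps)
                moreover have "psi k X = ?P - int k * ?P - 1 + sum (wt k) X"
                  by (simp add: psi_def algebra_simps)
                moreover have "psi ?l (part u r b d) = - 2 * (int k * ?P) - 1 + sum (wt ?l) (part u r b d)"
                  by (simp add: psi_def algebra_simps del: wt.simps)
                moreover have "wt ?l g \<le> 2 * ?P" "wt ?l b \<le> 2 * ?P"
                  using wt_le[of ?l g] wt_le[of ?l b] by simp_all
                ultimately show ?thesis using total' sum_m[of ?l] by linarith
              next
                case False
                define WW where "WW = {e \<in> W. tri k \<le> e}"
                define XX where "XX = {e \<in> X. tri ?l \<le> e}"
                have WX: "finite WW" "finite XX" "card WW < k" "card XX \<le> k"
                  using False finW finX cxk by (auto simp: WW_def XX_def cx_def)
                \<comment> \<open>Fewer than \<open>2 * k\<close> disks are in \<open>XX\<close> or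
                  \<open>WW\<close>, but at least \<open>2 * k + 3\<close> heavy disks lie below
                  \<open>g\<close>. So some heavy disk besides \<open>b\<close> travels from
                  \<open>d\<close> to \<open>f\<close> between \<open>r\<close> and
                  \<open>t\<close>.\<close>
                define M where "M = {e. e < b \<and> u r e = d \<and> u t e = f \<and> tri ?l \<le> e}"
                have finM: "finite M" by (simp add: M_def)
                have cover: "D \<in> M \<or> D = b \<or> D \<in> XX \<or> D \<in> WW" if "tri ?l \<le> D" "D < g" for D
                proof -
                  have "tri k \<le> D" using that tri_mono[of k ?l] by simp
                  then show ?thesis
                    using at_r[OF that(2)] n'max[OF that(2)] at_t[of D] same_t[of D] that
                    by (auto simp: M_def XX_def WW_def X_def W_def part_def)
                qed
                have "card {tri ?l..<g} \<le> card (M \<union> insert b (XX \<union> WW))"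
                proof (rule card_mono)
                  show "{tri ?l..<g} \<subseteq> M \<union> insert b (XX \<union> WW)"
                  proof
                    fix D assume "D \<in> {tri ?l..<g}"
                    then show "D \<in> M \<union> insert b (XX \<union> WW)" using cover[of D] unfolding atLeastLessThan_iff by blast
                  qed
                qed (use finM WX in auto)
                also have "\<dots> \<le> card M + card (insert b (XX \<union> WW))" by (rule card_Un_le)
                also have "card (insert b (XX \<union> WW)) \<le> Suc (card (XX \<union> WW))" by (rule card_insert_le_m1) auto
                also have "card (XX \<union> WW) \<le> card XX + card WW" by (rule card_Un_le)
                finally have "M \<noteq> {}" using WX m_big m by auto
                define q where "q = Max M"
                have "q \<in> M" using \<open>M \<noteq> {}\<close> finM unfolding q_def by (intro Max_in)
                then have q: "q < b" "u r q = d" "u t q = f" "tri ?l \<le> q" by (auto simp: M_def)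
                have qmax: "e \<le> q" if "e \<in> M" for e using that finM by (simp add: q_def)
                have qr: "u (Suc r) q = d" using same[of q] q bg by simp
                obtain a1 where a1: "Suc r \<le> a1" "a1 < t" "u a1 q = d" and ma1: "moved u a1 q"
                  by (rule first_leave[of "Suc r" t u q d]) (use tr q qr fv in auto)
                obtain b2 where b2: "a1 \<le> b2" "b2 < t" "u (Suc b2) q = f" and mb2: "moved u b2 q"
                  by (rule last_enter[of a1 t u q f]) (use a1 q fv in auto)
                have "psi k (part u (Suc r) q d) \<le> int (mv u {..<q} (Suc r) a1)"
                  using a1 by (intro clear_before_move[OF w ma1]) auto
                moreover have "psi k (part u t q f) \<le> int (mv u {..<q} (Suc b2) t)"
                  using b2 by (intro fill_after_move[OF w mb2]) auto
                moreover have "1 \<le> mv u {q} (Suc r) t" by (rule mv_pos[OF mb2]) (use a1 b2 in auto)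
                moreover have "mv u {..<q} (Suc r) t + mv u {q} (Suc r) t \<le> mv u {..<b} (Suc r) t"
                  using q by (intro mv_Un_le[OF w]) auto
                moreover have "mv u {..<q} (Suc r) a1 + mv u {..<q} (Suc b2) t \<le> mv u {..<q} (Suc r) t"
                  using a1 b2 by (intro mv_chain) auto
                \<comment> \<open>The largest travelling disk \<open>q\<close> separates clearing
                  \<open>d\<close> from filling \<open>f\<close>, so every disk below
                  \<open>q\<close> is counted twice: at \<open>r\<close> on \<open>s'\<close> or
                  \<open>d\<close>, and at \<open>t\<close> on \<open>v\<close> or \<open>f\<close>.
                  This doubling at level \<open>k\<close> replaces the doubled weights of level
                  \<open>?l\<close>.\<close>
                ultimately have total'': "psi k X + 1 + (psi k (part u (Suc r) q d) + 1 + psi k (part u t q f)) + 1 + psi k W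
                    \<le> int (mv u {..<m} i j)"
                  using total' by linarith
                define U where "U = {q<..<g} - {b}"
                have finU: "finite U" by (simp add: U_def)
                have cU: "card U + q + 2 = g"
                  using q bg by (simp add: U_def card_Diff_subset)
                have Ucov: "e \<in> XX \<or> e \<in> WW" if "e \<in> U" for e
                  using cover[of e] qmax[of e] that q by (auto simp: U_def)
                have "card U \<le> card (XX \<union> WW)" using Ucov WX by (intro card_mono) auto
                also have "\<dots> \<le> card XX + card WW" by (rule card_Un_le)
                finally have "g \<le> q + 2 * k + 1" using cU WX by simp
                then have "int g * ?P \<le> (int q + 2 * int k + 1) * ?P" by (intro mult_right_mono) auto
                also have "\<dots> = int q * ?P + 2 * (int k * ?P) + ?P" by (simp add: algebra_simps)
                finally have gq: "int g * ?P \<le> int q * ?P + 2 * (int k * ?P) + ?P" .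
                have bigU: "tri k \<le> e" if "e \<in> U" for e
                  using that q tri_mono[of k ?l] by (auto simp: U_def)
                have below: "D < b" "D < g" "u (Suc t) D = u t D" if "D < q" for D
                  using that q(1) bg same_t[of D] by auto
                have lower_r: "sum (wt k) {..<q} = sum (wt k) (part u r q s') + sum (wt k) (part u (Suc r) q d)"
                proof -
                  have "{..<q} = part u r q s' \<union> part u (Suc r) q d"
                    using at_r[OF below(2)] same[OF below(2)] by (auto simp: part_def)
                  moreover have "part u r q s' \<inter> part u (Suc r) q d = {}"
                    using same[OF below(2)] dist zd by (auto simp: part_def)
                  ultimately show ?thesis by (simp add: sum.union_disjoint)
                qed
                have lower_t: "sum (wt k) {..<q} = sum (wt k) (part u t q v) + sum (wt k) (part u t q f)"
                proof -
                  have "{..<q} = part u t q v \<union> part u t q f"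
                    using at_t[OF below(1)] by (auto simp: part_def)
                  moreover have "part u t q v \<inter> part u t q f = {}" using fv by (auto simp: part_def)
                  ultimately show ?thesis by (simp add: sum.union_disjoint)
                qed
                have upper: "sum (wt k) (part u r q s') + sum (wt k) (part u t q v) + int (card U) * ?P
                    \<le> sum (wt k) X + sum (wt k) W"
                proof -
                  have "part u r q s' \<union> (U \<inter> XX) \<subseteq> X" using below(2) by (auto simp: part_def X_def XX_def)
                  then have "sum (wt k) (part u r q s' \<union> (U \<inter> XX)) \<le> sum (wt k) X" using finX by (intro sum_wt_mono)
                  also have "sum (wt k) (part u r q s' \<union> (U \<inter> XX)) = sum (wt k) (part u r q s') + sum (wt k) (U \<inter> XX)"
                    using finU by (intro sum.union_disjoint) (auto simp: part_def U_def)
                  finally have 1: "sum (wt k) (part u r q s') + sum (wt k) (U \<inter> XX) \<le> sum (wt k) X" .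
                  have "part u t q v \<union> (U - XX) \<subseteq> W"
                    using below(2,3) Ucov by (auto simp: part_def W_def WW_def)
                  then have "sum (wt k) (part u t q v \<union> (U - XX)) \<le> sum (wt k) W" using finW by (intro sum_wt_mono)
                  also have "sum (wt k) (part u t q v \<union> (U - XX)) = sum (wt k) (part u t q v) + sum (wt k) (U - XX)"
                    using finU by (intro sum.union_disjoint) (auto simp: part_def U_def)
                  finally have 2: "sum (wt k) (part u t q v) + sum (wt k) (U - XX) \<le> sum (wt k) W" .
                  have "sum (wt k) (U \<inter> XX) + sum (wt k) (U - XX) = sum (wt k) U"
                    using finU by (simp add: sum.Int_Diff[symmetric])
                  also have "\<dots> = int (card U) * ?P" using bigU by (intro sum_wt_eq) auto
                  finally show ?thesis using 1 2 by linarith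
                qed
                have psi_eq: "psi k A = ?P - int k * ?P - 1 + sum (wt k) A" for A
                  by (simp add: psi_def algebra_simps)
                have "sum (wt k) {..<q} = (int k - 1) * ?P + 1 + (int q - int (tri k)) * ?P"
                  using q tri_mono[of k ?l] by (intro sum_wt_lessThan) auto
                also have "\<dots> = int k * ?P - ?P + 1 + int q * ?P - int (tri k) * ?P" by (simp add: algebra_simps)
                finally have sum_q: "sum (wt k) {..<q} = int k * ?P - ?P + 1 + int q * ?P - int (tri k) * ?P" .
                have "sum (wt ?l) {..<m} = (int ?l - 1) * 2 ^ ?l + 1 + (int m - int (tri ?l)) * 2 ^ ?l"
                  using m_big by (intro sum_wt_lessThan) auto
                then have goal: "(1 - 2 * int ?l) * 2 ^ ?l - 1 + sum (wt ?l) {..<m}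
                    = 2 * (int g * ?P) - 2 * (int (tri k) * ?P) - 4 * (int k * ?P) - 2 * ?P"
                  by (simp add: algebra_simps m tri.simps(2) del: wt.simps)
                have "int (card U) = int g - int q - 2" using cU by simp
                then have "int (card U) * ?P = (int g - int q - 2) * ?P" by (rule arg_cong)
                also have "\<dots> = int g * ?P - int q * ?P - 2 * ?P" by (simp add: algebra_simps)
                finally show ?thesis
                  unfolding goal using total'' lower_r lower_t upper gq sum_q psi_eq[of X] psi_eq[of W]
                    psi_eq[of "part u (Suc r) q d"] psi_eq[of "part u t q f"]
                    zero_le_power[of "2::int" k] by linarith
              qed
            qed
          qed
        qed
      qed
    qed
  qed
qed

section \<open>The move of the largest disk\<close>

lemma first_move:
  assumes "i \<le> t" "moved u t D"
  obtains s where "i \<le> s" "s \<le> t" "moved u s D" "\<And>r. i \<le> r \<Longrightarrow> r \<le> s \<Longrightarrow> u r D = u i D"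
proof -
  define t1 where "t1 = (if u t D = u i D then Suc t else t)"
  have t1: "i \<le> t1" "t1 \<le> Suc t" "u t1 D \<noteq> u i D" using assms by (auto simp: t1_def moved_def)
  show thesis
  proof (rule first_leave[of i t1 u D "u i D", OF t1(1) refl t1(3)])
    fix s assume s: "i \<le> s" "s < t1" "moved u s D"
      and const: "\<And>r. i \<le> r \<Longrightarrow> r \<le> s \<Longrightarrow> u r D = u i D"
    have "s \<le> t" using s(2) t1(2) by simp
    with s show thesis by (intro that[of s] const)
  qed
qed

lemma last_move:
  assumes "t < j" "moved u t D"
  obtains s where "t \<le> s" "s < j" "moved u s D" "\<And>r. Suc s \<le> r \<Longrightarrow> r \<le> j \<Longrightarrow> u r D = u j D"
proof -
  define t1 where "t1 = (if u t D = u j D then Suc t else t)"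
  have t1: "t \<le> t1" "t1 \<le> j" "u t1 D \<noteq> u j D" using assms by (auto simp: t1_def moved_def)
  show thesis
  proof (rule last_enter[of t1 j u D "u j D", OF t1(2,3) refl])
    fix s assume s: "t1 \<le> s" "s < j" "moved u s D"
      and const: "\<And>r. Suc s \<le> r \<Longrightarrow> r \<le> j \<Longrightarrow> u r D = u j D"
    have "t \<le> s" using s(1) t1(1) by simp
    with s show thesis by (intro that[of s] const)
  qed
qed

text \<open>If \<open>b\<close> leaves first, \<open>hop_lower\<close> covers the time up to the
  first move of \<open>a\<close>. If \<open>a\<close> leaves first, \<open>b\<close> still blocks
  \<open>d\<close> and the costs separate: one pile is built on the fourth peg before, the other is
  cleared from \<open>d\<close> after.\<close>

lemma centre_both_after:
  assumes w: "walk u" and mt: "moved u t p" and p: "p = Suc a" and pegs: "c < 4" "d < 4" "c \<noteq> d"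
    and at: "\<And>D. D < p \<Longrightarrow> u t D = c \<or> u t D = d" and a: "u t a = c" and b: "b < a" "u t b = d"
    and above: "\<And>D. D < p \<Longrightarrow> b < D \<Longrightarrow> u t D = c"
    and ma: "t < ta" "ta < T" "moved u ta a" and mb: "t < tb" "tb < T" "moved u tb b"
  shows "(1 - 2 * int l) * 2 ^ l + 1 + sum (wt l) {..<a} \<le> int (mv u {..<Suc p} t T)"
proof -
  obtain sa where sa: "t \<le> sa" "sa \<le> ta" "moved u sa a" "\<And>r. t \<le> r \<Longrightarrow> r \<le> sa \<Longrightarrow> u r a = u t a"
    by (rule first_move[OF less_imp_le[OF ma(1)] ma(3)]) (rule that)
  obtain sb where sb: "t \<le> sb" "sb \<le> tb" "moved u sb b" "\<And>r. t \<le> r \<Longrightarrow> r \<le> sb \<Longrightarrow> u r b = u t b"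
    by (rule first_move[OF less_imp_le[OF mb(1)] mb(3)]) (rule that)
  have "sa \<noteq> t" using walk_unique[OF w mt] sa(3) p by force
  then have ta: "Suc t \<le> sa" using sa(1) by simp
  have "sb \<noteq> t" using walk_unique[OF w mt] sb(3) b p by force
  then have tb: "Suc t \<le> sb" using sb(1) by simp
  have "sa \<noteq> sb" using walk_unique[OF w sa(3)] sb(3) b by force
  have usa: "u sa a = c" using sa(1) sa(4)[of sa] a by simp
  have same: "u (Suc t) D = u t D" if "D < p" for D using walk_avoid(3)[OF w mt that] .
  have p1: "1 \<le> mv u {p} t T" by (rule mv_pos[OF mt]) (use ma in auto)
  have a1: "1 \<le> mv u {a} t T" by (rule mv_pos[OF sa(3)]) (use sa ma in auto)
  have "{..<Suc p} = {..<a} \<union> ({a} \<union> {p})" by (auto simp: p)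
  then have Un: "mv u {..<Suc p} t T = mv u {..<a} t T + (mv u {a} t T + mv u {p} t T)"
    using mv_Un[OF w, of "{..<a}" "{a} \<union> {p}"] mv_Un[OF w, of "{a}" "{p}"] by (simp add: p)
  show ?thesis
  proof (cases "sb < sa")
    case True
    have "(1 - 2 * int l) * 2 ^ l - 1 + sum (wt l) {..<a} \<le> int (mv u {..<a} (Suc t) sa)"
    proof (rule hop_lower[OF w ta, of c d "u (Suc sa) a" a b])
      show "u (Suc t) D = c \<or> u (Suc t) D = d" if "D < a" for D using at[of D] same[of D] that p by simp
      show "u (Suc t) D = c" if "D < a" "b < D" for D using above[of D] same[of D] that p by simp
      show "u (Suc t) b = d" using same[of b] b p by simp
      show "\<exists>s\<ge>Suc t. s < sa \<and> moved u s b" using tb True sb by blast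
      show "avoids u sa a c" "avoids u sa a (u (Suc sa) a)" using move_avoids(1,2)[OF w sa(3)] usa by simp_all
      show "u (Suc sa) a \<noteq> c" using sa(3) usa by (simp add: moved_def)
    qed (use pegs b walk_peg[OF w] in auto)
    moreover have "mv u {..<a} (Suc t) sa \<le> mv u {..<a} t T" using sa ma by (intro mv_mono) auto
    ultimately show ?thesis using Un p1 a1 by linarith
  next
    case False
    then have lt: "sa < sb" using \<open>sa \<noteq> sb\<close> by simp
    define y where "y = u (Suc sa) a"
    have ub: "u r b = d" if "t \<le> r" "r \<le> sb" for r using sb(4)[OF that] b by simp
    have y: "y < 4" "y \<noteq> c" "y \<noteq> d"
      using walk_peg[OF w] sa(3) usa walk_avoid(2)[OF w sa(3) b(1)] ub[of sa] lt sa(1)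
      by (auto simp: y_def moved_def)
    obtain v where v: "v < 4" "v \<noteq> c" "v \<noteq> d" "v \<noteq> y" by (rule other_peg[of c d y]) (use y pegs in auto)
    have at_s: "u sa D = v \<or> u sa D = d" if "D < a" for D
      using four_pegs[of c d y v "u sa D"] walk_avoid(1,2)[OF w sa(3) that] usa walk_peg[OF w] pegs y v
      by (auto simp: y_def)
    have off_d: "u sa D \<noteq> d" if "b < D" "D < a" for D
    proof (rule blocked[OF w, of t sa b d D sa])
      show "u t D \<noteq> d" using above[of D] that p pegs by simp
    qed (use ub lt sa(1) that in auto)
    have "psi l (part u sa a v) \<le> int (mv u {..<a} t sa)"
      using sa(1) pegs v at p by (intro fill_from_two[OF w, of t sa c d]) auto
    moreover have "psi l (part u sa b d) \<le> int (mv u {..<b} (Suc sa) sb)"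
    proof -
      have "part u sa b d = part u (Suc sa) b d" using part_move[OF w sa(3), of b d] b by simp
      then show ?thesis using clear_before_move[OF w sb(3) order_refl, of "Suc sa" d l] lt ub[of sb] sb(1) by simp
    qed
    moreover have "mv u {..<b} (Suc sa) sb + mv u {b} (Suc sa) T \<le> mv u {..<a} (Suc sa) T"
    proof -
      have "mv u {..<b} (Suc sa) sb \<le> mv u {..<b} (Suc sa) T" using sb mb by (intro mv_mono) auto
      moreover have "mv u {..<b} (Suc sa) T + mv u {b} (Suc sa) T \<le> mv u {..<a} (Suc sa) T"
        using b by (intro mv_Un_le[OF w]) auto
      ultimately show ?thesis by simp
    qed
    moreover have "1 \<le> mv u {b} (Suc sa) T" by (rule mv_pos[OF sb(3)]) (use lt sb mb in auto)
    moreover have "mv u {..<a} t sa + mv u {..<a} (Suc sa) T \<le> mv u {..<a} t T"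
      using sa ma by (intro mv_chain) auto
    moreover have "sum (wt l) {..<a} = sum (wt l) (part u sa a v) + (sum (wt l) (part u sa b d) + wt l b)"
    proof -
      have "{..<a} = part u sa a v \<union> insert b (part u sa b d)"
      proof (intro equalityI subsetI)
        fix D assume "D \<in> {..<a}"
        then show "D \<in> part u sa a v \<union> insert b (part u sa b d)"
          using at_s[of D] off_d[of D] by (cases D b rule: linorder_cases) (auto simp: part_def)
      qed (use b in \<open>auto simp: part_def\<close>)
      moreover have "part u sa a v \<inter> insert b (part u sa b d) = {}"
        using v ub[of sa] lt sa(1) by (auto simp: part_def)
      moreover have "sum (wt l) (insert b (part u sa b d)) = sum (wt l) (part u sa b d) + wt l b"
        by (subst sum.insert) (auto simp: part_def)
      moreover have "finite (insert b (part u sa b d))" by simp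
      ultimately show ?thesis by (metis sum.union_disjoint finite_part)
    qed
    moreover have "(1 - 2 * int l) * 2 ^ l = 2 ^ l - 2 * (int l * 2 ^ l)" by (simp add: algebra_simps)
    moreover have "psi l (part u sa a v) = 2 ^ l - int l * 2 ^ l - 1 + sum (wt l) (part u sa a v)"
        "psi l (part u sa b d) = 2 ^ l - int l * 2 ^ l - 1 + sum (wt l) (part u sa b d)"
      by (simp_all add: psi_def algebra_simps)
    ultimately show ?thesis using Un p1 a1 wt_le[of l b] by linarith
  qed
qed

text \<open>The 3 counts moves of the central disk \<open>p\<close> and of the bottoms
  \<open>a\<close> and \<open>b\<close>; the bracket holds two constants of \<open>psi l\<close> and
  the weights. By \<open>tri l \<le> N - 3\<close> the third largest disk has the maximal weight
  \<open>2 ^ l\<close>, so no choice of \<open>b\<close> loses more than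
  \<open>b = N - 3\<close>.\<close>

lemma essential_walk_lower:
  assumes w: "walk u" and N: "3 \<le> N" and l: "tri l \<le> N - 3"
    and ess: "\<And>D. D < N \<Longrightarrow> \<exists>t<T. moved u t D"
  shows "3 + ((2 - 2 * int l) * 2 ^ l - 2 + sum (wt l) {..<N - 3}) \<le> int (mv u {..<N} 0 T)"
proof -
  define p where "p = N - 1"
  define a where "a = N - 2"
  have Np: "N = Suc p" "p = Suc a" using N by (auto simp: p_def a_def)
  have a3: "a = Suc (N - 3)" using N by (simp add: a_def)
  have sum_a: "sum (wt l) {..<a} = sum (wt l) {..<N - 3} + 2 ^ l"
    using wt_eq[OF l] unfolding a3 by simp
  obtain t where t: "t < T" and mt: "moved u t p" using ess[of p] Np by auto
  define c where "c = u t a"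
  have "a < p" using Np by simp
  note av = walk_avoid(1,2)[OF w mt]
  have c: "c < 4" "c \<noteq> u t p" "c \<noteq> u (Suc t) p" using av[OF \<open>a < p\<close>] walk_peg[OF w] by (auto simp: c_def)
  obtain d where d: "d < 4" "d \<noteq> u t p" "d \<noteq> u (Suc t) p" "d \<noteq> c"
    by (rule other_peg[of "u t p" "u (Suc t) p" c]) (use c walk_peg[OF w] in auto)
  have at: "u t D = c \<or> u t D = d" if "D < p" for D
    using four_pegs[of "u t p" "u (Suc t) p" c d "u t D"] av[OF that] c d walk_peg[OF w] mt
    by (auto simp: moved_def)
  have same: "u (Suc t) D = u t D" if "D < p" for D using walk_avoid(3)[OF w mt that] .
  have p1: "1 \<le> mv u {p} 0 T" by (rule mv_pos[OF mt]) (use t in auto)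
  have sides: "\<exists>s. (s < t \<or> t < s) \<and> s < T \<and> moved u s D" if "D < p" for D
  proof -
    have "D < N" using that Np(1) by simp
    from ess[OF this] obtain s where "s < T" "moved u s D" by blast
    moreover have "s \<noteq> t" using walk_unique[OF w mt, of D] \<open>moved u s D\<close> that by auto
    ultimately show ?thesis by (metis linorder_neqE_nat)
  qed
  have after: "psi l (part u t D (u t D)) \<le> int (mv u {..<D} (Suc t) T) \<and> 1 \<le> mv u {D} (Suc t) T"
    if D: "D < p" and s: "t < s" "s < T" "moved u s D" for D s
  proof -
    obtain s' where s': "Suc t \<le> s'" "s' \<le> s" "moved u s' D" "\<And>r. Suc t \<le> r \<Longrightarrow> r \<le> s' \<Longrightarrow> u r D = u (Suc t) D"
      by (rule first_move[OF Suc_leI[OF s(1)] s(3)]) (rule that)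
    have us: "u s' D = u t D" using s'(4)[of s'] s'(1) same[OF D] by simp
    have "psi l (part u (Suc t) D (u t D)) \<le> int (mv u {..<D} (Suc t) s')"
      using s'(1-2) us by (intro clear_before_move[OF w s'(3)]) auto
    moreover have "part u (Suc t) D (u t D) = part u t D (u t D)" using D by (intro part_move[OF w mt]) simp
    moreover have "mv u {..<D} (Suc t) s' \<le> mv u {..<D} (Suc t) T" using s'(1-2) s by (intro mv_mono) auto
    moreover have "1 \<le> mv u {D} (Suc t) T" by (rule mv_pos[OF s'(3)]) (use s'(1-2) s in auto)
    ultimately show ?thesis by simp
  qed
  have before: "psi l (part u t D (u t D)) \<le> int (mv u {..<D} 0 t) \<and> 1 \<le> mv u {D} 0 t"
    if D: "D < p" and s: "s < t" "moved u s D" for D s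
  proof -
    obtain s' where s': "s \<le> s'" "s' < t" "moved u s' D" "\<And>r. Suc s' \<le> r \<Longrightarrow> r \<le> t \<Longrightarrow> u r D = u t D"
      by (rule last_move[OF s]) (rule that)
    have us: "u (Suc s') D = u t D" using s'(4)[of "Suc s'"] s'(2) by simp
    have "psi l (part u t D (u t D)) \<le> int (mv u {..<D} (Suc s') t)"
      using s'(1-2) us by (intro fill_after_move[OF w s'(3)]) auto
    moreover have "mv u {..<D} (Suc s') t \<le> mv u {..<D} 0 t" using s'(1-2) s by (intro mv_mono) auto
    moreover have "1 \<le> mv u {D} 0 t" by (rule mv_pos[OF s'(3)]) (use s'(1-2) s in auto)
    ultimately show ?thesis by simp
  qed
  have whole: "mv u {..<p} 0 t + mv u {..<p} (Suc t) T + mv u {p} 0 T \<le> mv u {..<N} 0 T"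
    using mv_chain[of 0 t "Suc t" T u "{..<p}"] t mv_Un_le[OF w, of "{..<p}" "{p}" "{..<N}" 0 T] Np by auto
  have disk: "mv u {..<D} i j + mv u {D} i j \<le> mv u {..<p} i j" if "D < p" for D i j
    using that by (intro mv_Un_le[OF w]) auto
  define Q where "Q = int l * 2 ^ l"
  have Q0: "0 \<le> Q" by (simp add: Q_def)
  have exp: "psi l A = 2 ^ l - Q - 1 + sum (wt l) A" for A
    by (simp add: psi_def Q_def algebra_simps)
  have exp2: "(2 - 2 * int l) * 2 ^ l = 2 * 2 ^ l - 2 * Q"
    "(1 - 2 * int l) * 2 ^ l = 2 ^ l - 2 * Q" by (simp_all add: Q_def algebra_simps)
  show ?thesis
  proof (cases "part u t p d = {}")
    case True
    then have full: "part u t a c = {..<a}" using at Np by (auto simp: part_def)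
    have "psi l (part u t a c) + 1 \<le> int (mv u {..<p} 0 t) + int (mv u {..<p} (Suc t) T)"
      using sides[OF \<open>a < p\<close>] after[OF \<open>a < p\<close>] before[OF \<open>a < p\<close>] disk[OF \<open>a < p\<close>, of 0 t]
        disk[OF \<open>a < p\<close>, of "Suc t" T] by (fastforce simp: c_def)
    then show ?thesis using Q0 unfolding full using whole p1 sum_a exp[of "{..<a}"] exp2 by linarith
  next
    case False
    define b where "b = Max (part u t p d)"
    have "b \<in> part u t p d" using False unfolding b_def by (intro Max_in) auto
    then have b: "b < p" "u t b = d" by (auto simp: part_def)
    have bmax: "D \<le> b" if "D < p" "u t D = d" for D
      using that unfolding b_def by (intro Max_ge) (auto simp: part_def)
    have "b \<noteq> a" using b d c_def by auto
    then have ba: "b < a" using b Np by simp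
    have above: "u t D = c" if "D < p" "b < D" for D using at[OF that(1)] bmax[OF that(1)] that(2) by auto
    have parts: "sum (wt l) {..<a} = sum (wt l) (part u t a c) + (sum (wt l) (part u t b d) + wt l b)"
    proof -
      have "{..<a} = part u t a c \<union> insert b (part u t b d)"
      proof (intro equalityI subsetI)
        fix D assume "D \<in> {..<a}"
        then show "D \<in> part u t a c \<union> insert b (part u t b d)"
          using at[of D] bmax[of D] Np by (cases D b rule: linorder_cases) (auto simp: part_def)
      qed (use ba in \<open>auto simp: part_def\<close>)
      moreover have "part u t a c \<inter> insert b (part u t b d) = {}" using b d by (auto simp: part_def)
      moreover have "sum (wt l) (insert b (part u t b d)) = sum (wt l) (part u t b d) + wt l b"
        by (subst sum.insert) (auto simp: part_def)
      moreover have "finite (insert b (part u t b d))" by simp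
      ultimately show ?thesis by (metis sum.union_disjoint finite_part)
    qed
    obtain sa where sa: "sa < t \<or> t < sa" "sa < T" "moved u sa a" using sides[OF \<open>a < p\<close>] by blast
    obtain sb where sb: "sb < t \<or> t < sb" "sb < T" "moved u sb b" using sides[OF b(1)] by blast
    consider (aa) "t < sa" "t < sb" | (bb) "sa < t" "sb < t" | (ab) "t < sa" "sb < t" | (ba) "sa < t" "t < sb"
      using sa sb by blast
    then show ?thesis
    proof cases
      case aa
      have "(1 - 2 * int l) * 2 ^ l + 1 + sum (wt l) {..<a} \<le> int (mv u {..<Suc p} t T)"
        by (rule centre_both_after[OF w mt Np(2) c(1) d(1) d(4)[symmetric] at c_def[symmetric] ba b(2) above
              aa(1) sa(2,3) aa(2) sb(2,3)])
      moreover have "mv u {..<Suc p} t T \<le> mv u {..<N} 0 T" using Np by (intro mv_mono) auto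
      ultimately show ?thesis using sum_a exp2 by linarith
    next
      case bb
      \<comment> \<open>Reversed, the central move happens at time \<open>T - Suc t\<close> and
        starts from \<open>u (Suc t)\<close>, which agrees with \<open>u t\<close> below
        \<open>p\<close>.\<close>
      let ?v = "rev_walk T u" and ?t = "T - Suc t"
      have v: "?v ?t D = u (Suc t) D" for D using t by (simp add: rev_walk_def)
      have "(1 - 2 * int l) * 2 ^ l + 1 + sum (wt l) {..<a} \<le> int (mv ?v {..<Suc p} ?t T)"
      proof (rule centre_both_after[OF walk_rev[OF w] _ Np(2), where c = c and d = d and b = b
              and ta = "T - Suc sa" and tb = "T - Suc sb"])
        show "moved ?v ?t p" "moved ?v (T - Suc sa) a" "moved ?v (T - Suc sb) b"
          using mt t sa sb by (auto simp: moved_rev)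
        show "?v ?t D = c \<or> ?v ?t D = d" if "D < p" for D using at[OF that] same[OF that] v by simp
        show "?v ?t D = c" if "D < p" "b < D" for D using above[OF that] same[OF that(1)] v by simp
        show "?v ?t a = c" "?v ?t b = d" using same b \<open>a < p\<close> v by (auto simp: c_def)
      qed (use bb t sa sb ba c d in auto)
      moreover have "mv ?v {..<Suc p} ?t T = mv u {..<Suc p} 0 (Suc t)"
        using mv_rev[of 0 "Suc t" T u "{..<Suc p}"] t by simp
      moreover have "mv u {..<Suc p} 0 (Suc t) \<le> mv u {..<N} 0 T" using Np t by (intro mv_mono) auto
      ultimately show ?thesis using sum_a exp2 by linarith
    next
      case ab
      have "psi l (part u t a c) \<le> int (mv u {..<a} (Suc t) T) \<and> 1 \<le> mv u {a} (Suc t) T"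
        using after[OF \<open>a < p\<close> ab(1) sa(2,3)] by (simp only: c_def)
      moreover have "psi l (part u t b d) \<le> int (mv u {..<b} 0 t) \<and> 1 \<le> mv u {b} 0 t"
        using before[OF b(1) ab(2) sb(3)] by (simp only: b(2))
      ultimately show ?thesis
        using disk[OF \<open>a < p\<close>, of "Suc t" T] disk[OF b(1), of 0 t] whole p1 sum_a exp2
          exp[of "part u t a c"] exp[of "part u t b d"] parts wt_le[of l b] by linarith
    next
      case ba
      have "psi l (part u t a c) \<le> int (mv u {..<a} 0 t) \<and> 1 \<le> mv u {a} 0 t"
        using before[OF \<open>a < p\<close> ba(1) sa(3)] by (simp only: c_def)
      moreover have "psi l (part u t b d) \<le> int (mv u {..<b} (Suc t) T) \<and> 1 \<le> mv u {b} (Suc t) T"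
        using after[OF b(1) ba(2) sb(2,3)] by (simp only: b(2))
      ultimately show ?thesis
        using disk[OF \<open>a < p\<close>, of 0 t] disk[OF b(1), of "Suc t" T] whole p1 sum_a exp2
          exp[of "part u t a c"] exp[of "part u t b d"] parts wt_le[of l b] by linarith
    qed
  qed
qed

section \<open>The Frame--Stewart numbers for four pegs\<close>

text \<open>The function \<open>\<Phi>(4, n)\<close> is the maximum over \<open>s\<close> of these lines, attained where
  \<open>tri s \<le> n < tri (Suc s)\<close>.\<close>

definition line :: "nat \<Rightarrow> nat \<Rightarrow> int" where
  "line s n = (int n - 1 - int (tri s) + int s) * 2 ^ s + 1"

lemma tri_ge: "s \<le> tri s"
  by (induction s) (auto simp: tri.simps(2))

lemma int_double_plus: "int (2 * a + (2 ^ r - 1)) = 2 * int a + 2 ^ r - 1"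
proof -
  have "(1::nat) \<le> 2 ^ r" by simp
  then have "int (2 ^ r - 1) = 2 ^ r - 1" by (simp only: of_nat_diff) simp
  then show ?thesis unfolding of_nat_add of_nat_mult by simp
qed

lemma frame_stewart_0 [simp]: "frame_stewart p 0 = 0"
  by (simp add: frame_stewart.simps)

lemma frame_stewart_4_le:
  assumes "1 \<le> l" "l < n"
  shows "frame_stewart 4 n \<le> 2 * frame_stewart 4 l + (2 ^ (n - l) - 1)"
proof -
  have "frame_stewart 4 n \<le> 2 * frame_stewart 4 l + frame_stewart (4 - 1) (n - l)"
    using assms by (subst frame_stewart_rec) (auto intro!: Min_le)
  then show ?thesis using assms frame_stewart_3[of "n - l"] by simp
qed

text \<open>For \<open>n = 1\<close> the witness is \<open>l = 0\<close> with the conventional value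
  0, so the recursion also covers a single disk and the tower of small disks may be empty.\<close>

lemma frame_stewart_4_cases:
  assumes "1 \<le> n"
  obtains l where "l < n" "2 \<le> n \<Longrightarrow> 1 \<le> l" "frame_stewart 4 n = 2 * frame_stewart 4 l + (2 ^ (n - l) - 1)"
proof (cases "n = 1")
  case True
  then show ?thesis using frame_stewart_1[of 4] by (intro that[of 0]) auto
next
  case False
  let ?F = "\<lambda>l. 2 * frame_stewart 4 l + frame_stewart (4 - 1) (n - l)"
  have "Min (?F ` {1..<n}) \<in> ?F ` {1..<n}" using assms False by (intro Min_in) auto
  then obtain l where l: "l \<in> {1..<n}" "Min (?F ` {1..<n}) = ?F l" by blast
  have "frame_stewart 4 n = ?F l" using frame_stewart_rec[of 4 n] assms False l(2) by simp
  then show ?thesis using l frame_stewart_3[of "n - l"] by (intro that[of l]) auto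
qed

text \<open>For \<open>s = Suc k\<close>, twice the line of index \<open>k\<close> at
  \<open>l\<close> plus the secant line of \<open>2 ^ (n - l)\<close> at level \<open>s\<close> add
  up to \<open>line s n\<close>, whatever the split.\<close>

lemma frame_stewart_4_ge: "1 \<le> n \<Longrightarrow> line s n \<le> int (frame_stewart 4 n)"
proof (induction n arbitrary: s rule: less_induct)
  case (less n)
  show ?case
  proof (cases "n = 1")
    case True
    have "s \<le> tri s" by (rule tri_ge)
    then have "(int s - int (tri s)) * 2 ^ s \<le> 0" by (intro mult_nonpos_nonneg) auto
    then show ?thesis using True frame_stewart_1[of 4] by (simp add: line_def algebra_simps)
  next
    case False
    obtain l where l: "l < n" "2 \<le> n \<Longrightarrow> 1 \<le> l" and
        eq: "frame_stewart 4 n = 2 * frame_stewart 4 l + (2 ^ (n - l) - 1)"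
      by (rule frame_stewart_4_cases[OF less.prems]) (rule that)
    have "1 \<le> l" using l less.prems False by simp
    define r where "r = n - l"
    have n: "n = l + r" using l by (simp add: r_def)
    have eq': "int (frame_stewart 4 n) = 2 * int (frame_stewart 4 l) + 2 ^ r - 1"
      unfolding eq r_def by (rule int_double_plus)
    note IH = less.IH[OF l(1) \<open>1 \<le> l\<close>]
    show ?thesis
    proof (cases s)
      case 0
      have "1 + int r \<le> 2 ^ r" using two_power_line[of 1 r] by (cases r) auto
      then show ?thesis using IH[of 0] eq' n 0 \<open>1 \<le> l\<close> by (simp add: line_def)
    next
      case (Suc k)
      show ?thesis using IH[of k] eq' two_power_line[of "Suc k" r]
        by (simp add: line_def Suc n tri.simps(2) algebra_simps)
    qed
  qed
qed

text \<open>Splitting off the \<open>s\<close> largest disks leaves a number between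
  \<open>tri (s - 1)\<close> and \<open>tri s\<close>; at the right end the lines of index
  \<open>s - 1\<close> and \<open>s\<close> meet. The bound for smaller numbers is a hypothesis so
  that the lemma serves both inside the induction proving that bound and afterwards.\<close>

lemma frame_stewart_4_split:
  assumes "2 \<le> n" "tri s \<le> n" "n < tri (Suc s)"
    and IH: "\<And>l k. l < n \<Longrightarrow> 1 \<le> l \<Longrightarrow> tri k \<le> l \<Longrightarrow> l < tri (Suc k) \<Longrightarrow> int (frame_stewart 4 l) \<le> line k l"
  shows "s < n" "2 * int (frame_stewart 4 (n - s)) + 2 ^ s - 1 \<le> line s n"
proof -
  obtain k where s: "s = Suc k" using assms(1,3) by (cases s) (auto simp: tri.simps(2))
  show sn: "s < n"
  proof (cases k)
    case 0 then show ?thesis using assms(1) s by simp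
  next
    case (Suc k') then show ?thesis using assms(2) s by (simp add: tri.simps(2))
  qed
  define l where "l = n - s"
  have l: "l < n" "1 \<le> l" "tri k \<le> l" "l \<le> tri s" "n = l + s"
    using assms sn s by (auto simp: l_def tri.simps(2))
  have "int (frame_stewart 4 l) \<le> line k l"
  proof (cases "l = tri s")
    case True
    have "int (frame_stewart 4 l) \<le> line s l" using l True by (intro IH) (auto simp: tri.simps(2))
    also have "line s l = line k l" by (simp add: line_def True s tri.simps(2) algebra_simps)
    finally show ?thesis .
  next
    case False then show ?thesis using l s by (intro IH) auto
  qed
  then show "2 * int (frame_stewart 4 (n - s)) + 2 ^ s - 1 \<le> line s n"
    unfolding l_def[symmetric] by (simp add: line_def l(5) s tri.simps(2) algebra_simps)
qed

lemma frame_stewart_4_upper: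
  "1 \<le> n \<Longrightarrow> tri s \<le> n \<Longrightarrow> n < tri (Suc s) \<Longrightarrow> int (frame_stewart 4 n) \<le> line s n"
proof (induction n arbitrary: s rule: less_induct)
  case (less n)
  show ?case
  proof (cases "n = 1")
    case True
    have "s = 1" using less.prems True by (cases s; cases "s - 1") (auto simp: tri.simps(2))
    then show ?thesis using True frame_stewart_1[of 4] by (simp add: line_def tri.simps(2))
  next
    case False
    then have n: "2 \<le> n" using less.prems by simp
    note split = frame_stewart_4_split[OF n less.prems(2,3) less.IH]
    have s: "1 \<le> s" using less.prems by (cases s) (auto simp: tri.simps(2))
    have "frame_stewart 4 n \<le> 2 * frame_stewart 4 (n - s) + (2 ^ s - 1)"
      using frame_stewart_4_le[of "n - s" n] split(1) s by simp
    then have "int (frame_stewart 4 n) \<le> int (2 * frame_stewart 4 (n - s) + (2 ^ s - 1))"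
      by (simp only: of_nat_le_iff)
    then show ?thesis using split(2) unfolding int_double_plus by linarith
  qed
qed

lemma tri_interval:
  obtains s where "tri s \<le> n" "n < tri (Suc s)"
proof -
  have ex: "n < tri (Suc n)" using tri_ge[of "Suc n"] by simp
  define s where "s = (LEAST s. n < tri (Suc s))"
  have 1: "n < tri (Suc s)" unfolding s_def using ex by (rule LeastI)
  have "tri s \<le> n"
  proof (cases s)
    case (Suc k)
    then have "\<not> n < tri (Suc k)" unfolding s_def using not_less_Least[of k "\<lambda>s. n < tri (Suc s)"] by auto
    then show ?thesis using Suc by simp
  qed simp
  with 1 show ?thesis by (rule that[rotated])
qed

text \<open>The optimal index of \<open>N\<close> is \<open>s = l + 2\<close>. From
  \<open>tri s = tri l + 2 * l + 3\<close> and \<open>2 ^ s = 4 * 2 ^ l\<close> come the offset 3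
  and the factor 4. The same \<open>s\<close> gives the optimal split on which the construction
  rests.\<close>

lemma frame_stewart_4_level:
  assumes "3 \<le> N"
  obtains l where "tri l \<le> N - 3"
    "int (frame_stewart 4 N) = 5 + 4 * ((2 - 2 * int l) * 2 ^ l - 2 + sum (wt l) {..<N - 3})"
    "l + 2 < N" "frame_stewart 4 N = 2 * frame_stewart 4 (N - (l + 2)) + (2 ^ (l + 2) - 1)"
proof -
  obtain s where s: "tri s \<le> N" "N < tri (Suc s)" by (rule tri_interval) (rule that)
  have "2 \<le> s" using s assms by (cases s; cases "s - 1") (auto simp: tri.simps(2))
  define l where "l = s - 2"
  have l: "s = l + 2" using \<open>2 \<le> s\<close> by (simp add: l_def)
  have "s = Suc (Suc l)" using l by simp
  then have tri: "tri s = tri l + 2 * l + 3" by (simp add: tri.simps(2))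
  have tl: "tri l \<le> N - 3" using s(1) tri by simp
  have fs: "int (frame_stewart 4 N) = line s N"
    using frame_stewart_4_ge[of N s] frame_stewart_4_upper[of N s] s assms by simp
  also have "line s N = 5 + 4 * ((2 - 2 * int l) * 2 ^ l - 2 + sum (wt l) {..<N - 3})"
    using sum_wt_lessThan[OF tl] assms unfolding line_def tri unfolding l
    by (simp add: of_nat_diff power_add algebra_simps)
  finally have eq: "int (frame_stewart 4 N) = 5 + 4 * ((2 - 2 * int l) * 2 ^ l - 2 + sum (wt l) {..<N - 3})" .
  have two: "2 \<le> N" using assms by simp
  note split = frame_stewart_4_split[OF two s frame_stewart_4_upper]
  have "frame_stewart 4 N \<le> 2 * frame_stewart 4 (N - s) + (2 ^ s - 1)"
    using frame_stewart_4_le[of "N - s" N] split(1) \<open>2 \<le> s\<close> by simp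
  moreover have "int (2 * frame_stewart 4 (N - s) + (2 ^ s - 1)) \<le> int (frame_stewart 4 N)"
    using split(2) fs unfolding int_double_plus by linarith
  ultimately have "frame_stewart 4 N = 2 * frame_stewart 4 (N - s) + (2 ^ s - 1)" by simp
  then show ?thesis using that[OF tl eq] split(1) l by simp
qed

section \<open>Paths in the Hanoi graph\<close>

lemma hanoi_vertsD: "u \<in> hanoi_verts p N \<Longrightarrow> D < N \<Longrightarrow> u D < p"
  by (auto simp: hanoi_verts_def)

section \<open>Tower transfers as powers of adjacency\<close>

lemma adj_move:
  assumes "u \<in> hanoi_verts 4 N" "D < N" "y < 4" "y \<noteq> u D" "\<And>D'. D' < D \<Longrightarrow> u D' \<noteq> u D \<and> u D' \<noteq> y"
  shows "hanoi_adj 4 N u (u(D := y))"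
proof -
  have "u(D := y) \<in> hanoi_verts 4 N"
    using assms(1-3) by (auto simp: hanoi_verts_def PiE_iff extensional_def)
  then show ?thesis using assms by (auto simp: hanoi_adj_def legal_move_def)
qed

text \<open>The disks below \<open>lo\<close> wait on the fourth peg. An exact relation power
  records the number of moves, so lengths add by composition.\<close>

lemma adj_tower3:
  assumes "u \<in> hanoi_verts 4 N" "lo + k \<le> N" "p < 4" "q < 4" "r < 4" "distinct [p, q, r]"
    and "\<And>D. lo \<le> D \<Longrightarrow> D < lo + k \<Longrightarrow> u D = p" "\<And>D. D < lo \<Longrightarrow> u D \<notin> {p, q, r}"
  shows "(hanoi_adj 4 N ^^ (2 ^ k - 1)) u (\<lambda>D. if lo \<le> D \<and> D < lo + k then q else u D)"
  using assms
proof (induction k arbitrary: u p q r)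
  case 0
  have "(\<lambda>D. if lo \<le> D \<and> D < lo + 0 then q else u D) = u" by auto
  then show ?case by simp
next
  case (Suc k)
  let ?mv = "\<lambda>k q u D. if lo \<le> D \<and> D < lo + k then q else u D :: nat"
  have verts: "?mv j y u \<in> hanoi_verts 4 N" if "u \<in> hanoi_verts 4 N" "lo + j \<le> N" "y < 4" for u j y
    using that by (auto simp: hanoi_verts_def PiE_iff extensional_def)
  define u1 where "u1 = ?mv k r u"
  define u2 where "u2 = u1(lo + k := q)"
  have u1: "u1 \<in> hanoi_verts 4 N" unfolding u1_def using Suc.prems by (intro verts) auto
  have 1: "(hanoi_adj 4 N ^^ (2 ^ k - 1)) u u1"
    unfolding u1_def using Suc.prems by (intro Suc.IH[of u p r q]) auto
  have 2: "hanoi_adj 4 N u1 u2"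
    unfolding u2_def by (rule adj_move[OF u1]) (use Suc.prems in \<open>auto simp: u1_def\<close>)
  then have u2: "u2 \<in> hanoi_verts 4 N" by (simp add: hanoi_adj_def)
  have 3: "(hanoi_adj 4 N ^^ (2 ^ k - 1)) u2 (?mv k q u2)"
    by (rule Suc.IH[of u2 r q p, OF u2]) (use Suc.prems in \<open>auto simp: u2_def u1_def\<close>)
  have 2: "(hanoi_adj 4 N ^^ 1) u1 u2" using 2 by (simp only: relpowp_1)
  have mv: "?mv k q u2 = ?mv (Suc k) q u" by (auto simp: u2_def u1_def fun_eq_iff)
  have "(2 ^ k - 1) + 1 + (2 ^ k - 1) = (2 ^ Suc k - 1 :: nat)"
    using one_le_power[of "2 :: nat" k] unfolding power_Suc by linarith
  with relpowp_trans[OF relpowp_trans[OF 1 2] 3] show ?case unfolding mv by metis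
qed

lemma adj_tower4:
  assumes "u \<in> hanoi_verts 4 N" "n \<le> N" "p < 4" "q < 4" "p \<noteq> q" "\<And>D. D < n \<Longrightarrow> u D = p"
  shows "(hanoi_adj 4 N ^^ frame_stewart 4 n) u (\<lambda>D. if D < n then q else u D)"
  using assms
proof (induction n arbitrary: u p q rule: less_induct)
  case (less n)
  show ?case
  proof (cases "n = 0")
    case True then show ?thesis by simp
  next
    case False
    then have "1 \<le> n" by simp
    obtain l where l: "l < n" and fs: "frame_stewart 4 n = 2 * frame_stewart 4 l + (2 ^ (n - l) - 1)"
      by (rule frame_stewart_4_cases[OF \<open>1 \<le> n\<close>]) (rule that)
    obtain r where r: "r < 4" "r \<noteq> p" "r \<noteq> q" by (rule other_peg[of p q q]) (use less.prems in auto)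
    obtain x where x: "x < 4" "x \<noteq> p" "x \<noteq> q" "x \<noteq> r" by (rule other_peg[of p q r]) (use less.prems r in auto)
    have verts: "(\<lambda>D. if D < j then y else u D) \<in> hanoi_verts 4 N"
      if "u \<in> hanoi_verts 4 N" "j \<le> N" "y < 4" for u j y
      using that by (auto simp: hanoi_verts_def PiE_iff extensional_def)
    define u1 where "u1 = (\<lambda>D. if D < l then r else u D)"
    define u2 where "u2 = (\<lambda>D. if l \<le> D \<and> D < l + (n - l) then q else u1 D)"
    have u1: "u1 \<in> hanoi_verts 4 N" unfolding u1_def using less.prems l r by (intro verts) auto
    have 1: "(hanoi_adj 4 N ^^ frame_stewart 4 l) u u1"
      unfolding u1_def using less.prems l r by (intro less.IH[of l u p r]) auto
    have 2: "(hanoi_adj 4 N ^^ (2 ^ (n - l) - 1)) u1 u2"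
      unfolding u2_def
      by (rule adj_tower3[of u1 N l "n - l" p q x, OF u1]) (use less.prems l r x in \<open>auto simp: u1_def\<close>)
    have u2: "u2 \<in> hanoi_verts 4 N"
      using u1 less.prems by (auto simp: u2_def hanoi_verts_def PiE_iff extensional_def)
    have 3: "(hanoi_adj 4 N ^^ frame_stewart 4 l) u2 (\<lambda>D. if D < l then q else u2 D)"
      by (rule less.IH[of l u2 r q, OF l u2]) (use less.prems l r in \<open>auto simp: u2_def u1_def\<close>)
    have "(\<lambda>D. if D < l then q else u2 D) = (\<lambda>D. if D < n then q else u D)"
      using l by (auto simp: u2_def u1_def fun_eq_iff)
    then show ?thesis
      using relpowp_trans[OF relpowp_trans[OF 1 2] 3] fs by (simp add: add.commute add.left_commute mult_2)
  qed
qed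

text \<open>Endpoints that differ in every disk force every disk to move, so essentiality is read
  off from the two ends.\<close>

lemma essential_from_adj:
  assumes adj: "(hanoi_adj 4 N ^^ k) u v" and u: "u \<in> hanoi_verts 4 N" and diff: "\<And>D. D < N \<Longrightarrow> u D \<noteq> v D"
  shows "\<exists>\<gamma>. path_length \<gamma> = k \<and> essential_path 4 N \<gamma>"
proof -
  obtain f where f: "f 0 = u" "f k = v" "\<And>i. i < k \<Longrightarrow> hanoi_adj 4 N (f i) (f (Suc i))"
    using adj unfolding relpowp_fun_conv by blast
  define \<gamma> where "\<gamma> = map f [0..<Suc k]"
  have len: "length \<gamma> = Suc k" by (simp add: \<gamma>_def)
  have nth: "\<gamma> ! i = f i" if "i \<le> k" for i using that by (simp add: \<gamma>_def del: upt_Suc)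
  have verts: "f i \<in> hanoi_verts 4 N" if "i \<le> k" for i
    using that f(1,3) u by (cases i) (auto simp: hanoi_adj_def)
  have "hanoi_path 4 N \<gamma>"
    unfolding hanoi_path_def using len nth f(3) verts by (auto simp: \<gamma>_def)
  moreover have "\<exists>t. Suc t < length \<gamma> \<and> (\<gamma> ! t) D \<noteq> (\<gamma> ! Suc t) D" if D: "D < N" for D
  proof -
    obtain t where t: "t < k" "f t D = u D" "f (Suc t) D \<noteq> u D"
      using first_leave[of 0 k f D "u D"] diff[OF D] f(1,2) by (metis zero_le)
    then show ?thesis using nth[of t] nth[of "Suc t"] len by (intro exI[of _ t]) auto
  qed
  ultimately show ?thesis
    using len by (intro exI[of _ \<gamma>]) (auto simp: essential_path_def path_length_def)
qed

section \<open>From essential paths to walks, and the value of Gamma\<close>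

lemma essential_path_walk:
  assumes "essential_path 4 N \<gamma>"
  obtains u where "walk u" "\<And>D. D < N \<Longrightarrow> \<exists>t<path_length \<gamma>. moved u t D"
proof -
  define T where "T = path_length \<gamma>"
  have len: "length \<gamma> = Suc T"
    using assms by (auto simp: T_def path_length_def essential_path_def hanoi_path_def)
  have verts: "\<gamma> ! i \<in> hanoi_verts 4 N" if "i \<le> T" for i
    using assms that len by (auto simp: essential_path_def hanoi_path_def)
  have adj: "hanoi_adj 4 N (\<gamma> ! t) (\<gamma> ! Suc t)" if "t < T" for t
    using assms that len by (auto simp: essential_path_def hanoi_path_def)
  define u where "u = (\<lambda>t D. if D < N then (\<gamma> ! min t T) D else 0)"
  have peg: "u t D < 4" for t D using hanoi_vertsD[OF verts, of "min t T" D] by (simp add: u_def)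
  have step: "D' \<noteq> D \<longrightarrow> \<not> moved u t D' \<and> (D' < D \<longrightarrow> u t D' \<noteq> u t D \<and> u t D' \<noteq> u (Suc t) D)"
    if m: "moved u t D" for t D D'
  proof -
    have t: "t < T" using m by (rule contrapos_pp) (simp add: moved_def u_def min_absorb2)
    then have D: "D < N" and mD: "(\<gamma> ! t) D \<noteq> (\<gamma> ! Suc t) D"
      using m by (auto simp: moved_def u_def min_absorb1 split: if_splits)
    \<comment> \<open>Adjacency admits a legal move in either direction; smaller disks agree in both
      configurations, so the conditions are symmetric.\<close>
    obtain D0 where D0: "D0 < N" "\<And>D'. D' \<noteq> D0 \<Longrightarrow> (\<gamma> ! Suc t) D' = (\<gamma> ! t) D'"
        "\<And>D'. D' < D0 \<Longrightarrow> (\<gamma> ! t) D' \<noteq> (\<gamma> ! t) D0 \<and> (\<gamma> ! t) D' \<noteq> (\<gamma> ! Suc t) D0"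
    proof -
      consider "legal_move 4 N (\<gamma> ! t) (\<gamma> ! Suc t)" | "legal_move 4 N (\<gamma> ! Suc t) (\<gamma> ! t)"
        using adj[OF t] by (auto simp: hanoi_adj_def)
      then show ?thesis
      proof cases
        case 1
        then obtain D0 y where "D0 < N" "\<forall>D'<D0. (\<gamma> ! t) D' \<noteq> (\<gamma> ! t) D0 \<and> (\<gamma> ! t) D' \<noteq> y" "\<gamma> ! Suc t = (\<gamma> ! t)(D0 := y)"
          by (auto simp: legal_move_def)
        then show ?thesis by (intro that[of D0]) auto
      next
        case 2
        then obtain D0 y where "D0 < N" "\<forall>D'<D0. (\<gamma> ! Suc t) D' \<noteq> (\<gamma> ! Suc t) D0 \<and> (\<gamma> ! Suc t) D' \<noteq> y"
            "\<gamma> ! t = (\<gamma> ! Suc t)(D0 := y)"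
          by (auto simp: legal_move_def)
        then show ?thesis by (intro that[of D0]) auto
      qed
    qed
    have "D = D0" using D0(2)[of D] mD by auto
    then show ?thesis using D0 D t by (auto simp: moved_def u_def min_def)
  qed
  have "walk u" using peg step by (simp add: walk_def)
  moreover have "\<exists>t<path_length \<gamma>. moved u t D" if D: "D < N" for D
  proof -
    obtain t where "Suc t < length \<gamma>" "(\<gamma> ! t) D \<noteq> (\<gamma> ! Suc t) D"
      using assms D by (auto simp: essential_path_def)
    then show ?thesis using D len by (intro exI[of _ t]) (auto simp: moved_def u_def T_def[symmetric])
  qed
  ultimately show ?thesis by (rule that)
qed

lemma mv_le: "mv u S i j \<le> j - i"
  unfolding mv_def by (rule order_trans[OF card_mono[of "{i..<j}"]]) auto

lemma hanoi_Gamma_eqI: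
  assumes "essential_path p N \<gamma>" "\<And>\<gamma>'. essential_path p N \<gamma>' \<Longrightarrow> path_length \<gamma> \<le> path_length \<gamma>'"
  shows "hanoi_Gamma p N = path_length \<gamma>"
  unfolding hanoi_Gamma_def using assms by (intro cInf_eq_minimum) auto

lemma hanoi_Gamma_small:
  assumes "N \<le> 2"
  shows "hanoi_Gamma 4 N = N"
proof -
  have "\<exists>\<gamma>. path_length \<gamma> = N \<and> essential_path 4 N \<gamma>"
  proof -
    consider "N = 0" | "N = 1" | "N = 2" using assms by linarith
    then show ?thesis
    proof cases
      case 1
      have "(hanoi_adj 4 N ^^ N) (\<lambda>_. undefined) (\<lambda>_. undefined)" by (simp add: 1)
      then show ?thesis by (rule essential_from_adj) (auto simp: 1 hanoi_verts_def)
    next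
      case 2
      define u :: "nat \<Rightarrow> nat" where "u = (\<lambda>_. undefined)(0 := 0)"
      have u: "u \<in> hanoi_verts 4 N" by (auto simp: u_def 2 hanoi_verts_def PiE_iff extensional_def)
      have "hanoi_adj 4 N u (u(0 := 1))" by (rule adj_move[OF u]) (auto simp: u_def 2)
      then have "(hanoi_adj 4 N ^^ N) u (u(0 := 1))" by (simp only: 2 relpowp_1)
      then show ?thesis using u by (rule essential_from_adj) (auto simp: 2 u_def)
    next
      case 3
      \<comment> \<open>Four pegs let both disks move once without interfering: disk 1 from 0 to 1,
        then disk 0 from 2 to 3.\<close>
      define u :: "nat \<Rightarrow> nat" where "u = (\<lambda>_. undefined)(0 := 2, 1 := 0)"
      have u: "u \<in> hanoi_verts 4 N" by (auto simp: u_def 3 hanoi_verts_def PiE_iff extensional_def)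
      have 1: "hanoi_adj 4 N u (u(1 := 1))" by (rule adj_move[OF u]) (auto simp: u_def 3)
      then have v: "u(1 := 1) \<in> hanoi_verts 4 N" by (simp add: hanoi_adj_def)
      have "hanoi_adj 4 N (u(1 := 1)) ((u(1 := 1))(0 := 3))" by (rule adj_move[OF v]) (auto simp: u_def 3)
      with 1 have "(hanoi_adj 4 N ^^ N) u ((u(1 := 1))(0 := 3))"
        by (auto simp: 3 numeral_2_eq_2)
      then show ?thesis using u by (rule essential_from_adj) (auto simp: 3 u_def less_2_cases_iff)
    qed
  qed
  then obtain \<gamma> where \<gamma>: "path_length \<gamma> = N" "essential_path 4 N \<gamma>" by blast
  have "N \<le> path_length \<gamma>'" if ess: "essential_path 4 N \<gamma>'" for \<gamma>'
  proof -
    obtain u where u: "walk u" "\<And>D. D < N \<Longrightarrow> \<exists>t<path_length \<gamma>'. moved u t D"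
      by (rule essential_path_walk[OF ess]) (rule that)
    have "card {..<N} \<le> mv u {..<N} 0 (path_length \<gamma>')" using u(2) by (intro mv_each[OF u(1)]) auto
    also have "\<dots> \<le> path_length \<gamma>'" using mv_le[of u "{..<N}" 0] by simp
    finally show ?thesis by simp
  qed
  then show ?thesis using hanoi_Gamma_eqI[OF \<gamma>(2)] \<gamma>(1) by simp
qed

text \<open>The central move takes \<open>M + 2\<close> from \<open>0\<close> to \<open>1\<close>. Before it, \<open>M\<close> moves from \<open>1\<close> to \<open>3\<close> and the
  \<open>k\<close> disks above \<open>M + 2\<close> follow it. After it, the \<open>m\<close> smallest disks move from \<open>2\<close> to \<open>1\<close> by a
  four-peg transfer and the next \<open>j\<close> ones from \<open>2\<close> to \<open>3\<close> by a three-peg transfer, which frees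
  \<open>M + 1\<close>.\<close>

lemma essential_path_exists:
  "\<exists>\<gamma>. path_length \<gamma> = 3 + frame_stewart 4 m + (2 ^ j - 1) + (2 ^ k - 1) \<and> essential_path 4 (m + j + k + 3) \<gamma>"
proof -
  define M where "M = m + j + k"
  define N where "N = M + 3"
  define u0 :: "nat \<Rightarrow> nat" where "u0 = (\<lambda>D. if D < m + j then 2 else if D < M then 0 else if D = M then 1
      else if D = M + 1 then 2 else if D = M + 2 then 0 else undefined)"
  define u1 where "u1 = u0(M := 3)"
  define u2 where "u2 = (\<lambda>D. if m + j \<le> D \<and> D < m + j + k then 3 else u1 D)"
  define u3 where "u3 = u2(M + 2 := 1)"
  define u4 where "u4 = (\<lambda>D. if D < m then 1 else u3 D)"
  define u5 where "u5 = (\<lambda>D. if m \<le> D \<and> D < m + j then 3 else u4 D)"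
  define u6 where "u6 = u5(M + 1 := 0)"
  note defs = u6_def u5_def u4_def u3_def u2_def u1_def u0_def M_def
  have v0: "u0 \<in> hanoi_verts 4 N"
    by (auto simp: u0_def N_def M_def hanoi_verts_def PiE_iff extensional_def)
  have s1: "hanoi_adj 4 N u0 u1"
    unfolding u1_def by (rule adj_move[OF v0]) (auto simp: N_def u0_def M_def)
  then have v1: "u1 \<in> hanoi_verts 4 N" by (simp add: hanoi_adj_def)
  have s2: "(hanoi_adj 4 N ^^ (2 ^ k - 1)) u1 u2"
    unfolding u2_def by (rule adj_tower3[of u1 N "m + j" k 0 3 1, OF v1]) (auto simp: N_def u1_def u0_def M_def)
  have v2: "u2 \<in> hanoi_verts 4 N"
    using v1 by (auto simp: u2_def N_def M_def hanoi_verts_def PiE_iff extensional_def)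
  have s3: "hanoi_adj 4 N u2 u3"
    unfolding u3_def by (rule adj_move[OF v2]) (auto simp: N_def u2_def u1_def u0_def M_def)
  then have v3: "u3 \<in> hanoi_verts 4 N" by (simp add: hanoi_adj_def)
  have s4: "(hanoi_adj 4 N ^^ frame_stewart 4 m) u3 u4"
    unfolding u4_def by (rule adj_tower4[of u3 N m 2 1, OF v3]) (auto simp: N_def u3_def u2_def u1_def u0_def M_def)
  have v4: "u4 \<in> hanoi_verts 4 N"
    using v3 by (auto simp: u4_def N_def M_def hanoi_verts_def PiE_iff extensional_def)
  have s5: "(hanoi_adj 4 N ^^ (2 ^ j - 1)) u4 u5"
    unfolding u5_def by (rule adj_tower3[of u4 N m j 2 3 0, OF v4]) (auto simp: N_def u4_def u3_def u2_def u1_def u0_def M_def)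
  have v5: "u5 \<in> hanoi_verts 4 N"
    using v4 by (auto simp: u5_def N_def M_def hanoi_verts_def PiE_iff extensional_def)
  have s6: "hanoi_adj 4 N u5 u6"
    unfolding u6_def by (rule adj_move[OF v5]) (auto simp: N_def u5_def u4_def u3_def u2_def u1_def u0_def M_def)
  have one: "(hanoi_adj 4 N ^^ 1) u v" if "hanoi_adj 4 N u v" for u v
    using that by (simp only: relpowp_1)
  have "(hanoi_adj 4 N ^^ (1 + (2 ^ k - 1) + 1 + frame_stewart 4 m + (2 ^ j - 1) + 1)) u0 u6"
    by (rule relpowp_trans[OF relpowp_trans[OF relpowp_trans[OF relpowp_trans[OF relpowp_trans[OF
          one[OF s1] s2] one[OF s3]] s4] s5] one[OF s6]])
  moreover have "1 + (2 ^ k - 1) + 1 + frame_stewart 4 m + (2 ^ j - 1) + 1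
      = 3 + frame_stewart 4 m + (2 ^ j - 1) + (2 ^ k - 1)" by simp
  ultimately have "(hanoi_adj 4 N ^^ (3 + frame_stewart 4 m + (2 ^ j - 1) + (2 ^ k - 1))) u0 u6" by metis
  moreover have "u0 D \<noteq> u6 D" if "D < N" for D
    using that by (auto simp: defs N_def)
  ultimately show ?thesis using essential_from_adj[OF _ v0] unfolding N_def M_def by blast
qed

theorem theorem5:
  fixes N :: nat
  shows "real (hanoi_Gamma 4 N) =
    (if N \<le> 2 then real N else 3 + (real (frame_stewart 4 N) - 5) / 4)"
proof (cases "N \<le> 2")
  case True
  then show ?thesis using hanoi_Gamma_small by simp
next
  case False
  then have N: "3 \<le> N" by simp
  obtain l where l: "tri l \<le> N - 3"
      and fs: "int (frame_stewart 4 N) = 5 + 4 * ((2 - 2 * int l) * 2 ^ l - 2 + sum (wt l) {..<N - 3})"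
      and lN: "l + 2 < N" and rec1: "frame_stewart 4 N = 2 * frame_stewart 4 (N - (l + 2)) + (2 ^ (l + 2) - 1)"
    by (rule frame_stewart_4_level[OF N]) (rule that)
  have "1 \<le> N - (l + 2)" using lN by simp
  then obtain m where m: "m < N - (l + 2)"
      and rec2: "frame_stewart 4 (N - (l + 2)) = 2 * frame_stewart 4 m + (2 ^ (N - (l + 2) - m) - 1)"
    by (rule frame_stewart_4_cases) (rule that)
  \<comment> \<open>The three-peg parts of the two splits have \<open>l + 2\<close> and
    \<open>Suc j\<close> disks. Two disks of the first and one of the second become those that move
    once, leaving towers of \<open>l\<close> and \<open>j\<close>.\<close>
  define j where "j = N - (l + 2) - m - 1"
  have Nm: "m + j + l + 3 = N" and j: "N - (l + 2) - m = Suc j" using m lN by (auto simp: j_def)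
  define X where "X = (2 - 2 * int l) * 2 ^ l - 2 + sum (wt l) {..<N - 3}"
  have fs: "int (frame_stewart 4 N) = 5 + 4 * X" using fs unfolding X_def .
  obtain \<gamma> where len: "path_length \<gamma> = 3 + frame_stewart 4 m + (2 ^ j - 1) + (2 ^ l - 1)"
      and ess: "essential_path 4 N \<gamma>"
    using essential_path_exists[of m j l] unfolding Nm by blast
  have len': "4 * int (path_length \<gamma>) = int (frame_stewart 4 N) + 7"
  proof -
    \<comment> \<open>The splits give
      \<open>\<Phi>(4, N) = 4 * (\<Phi>(4, m) + 2 ^ j + 2 ^ l) - 3\<close>, and the path has
      \<open>\<Phi>(4, m) + 2 ^ j + 2 ^ l + 1\<close> moves.\<close>
    have "(2 :: nat) ^ (l + 2) = 4 * 2 ^ l" "(2 :: nat) ^ Suc j = 2 * 2 ^ j" by (simp_all add: power_add)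
    moreover have "(1 :: nat) \<le> 2 ^ l" "(1 :: nat) \<le> 2 ^ j" by simp_all
    ultimately show ?thesis using len rec1 rec2 unfolding j by linarith
  qed
  have "path_length \<gamma> \<le> path_length \<gamma>'" if ess': "essential_path 4 N \<gamma>'" for \<gamma>'
  proof -
    obtain u where u: "walk u" "\<And>D. D < N \<Longrightarrow> \<exists>t<path_length \<gamma>'. moved u t D"
      by (rule essential_path_walk[OF ess']) (rule that)
    have "3 + X \<le> int (mv u {..<N} 0 (path_length \<gamma>'))"
      unfolding X_def using u by (intro essential_walk_lower[OF _ N l]) auto
    moreover have "mv u {..<N} 0 (path_length \<gamma>') \<le> path_length \<gamma>'" using mv_le[of u "{..<N}" 0 "path_length \<gamma>'"] by simp
    ultimately show ?thesis using fs len' by linarith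
  qed
  then have "hanoi_Gamma 4 N = path_length \<gamma>" by (rule hanoi_Gamma_eqI[OF ess])
  moreover have "4 * real (path_length \<gamma>) = real (frame_stewart 4 N) + 7"
    using len' by linarith
  ultimately show ?thesis using False by (simp add: field_simps)
qed

end
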